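(* Let $\beta>1$ and consider the three-block model with block sizes $|B_1|=|B_3|=\frac{N-b_N}{2}$, $|B_2|=b_N$, inter-block interaction strength $\alpha_N>0$ with $\alpha_N\downarrow0$, Gibbs measure $\mu_{N,\beta,\alpha_N}$ and magnetization vector $m=(m_1,m_2,m_3)$. As $N\to\infty$ the following hold. (1) If $\lim_{N\to\infty}\alpha_N\sqrt{N/b_N}=c$ for some constant $c\in(0,\infty)$, then the distribution of $m$ under the Gibbs measure converges weakly to $$\frac12\left(\delta_{(m^*,m(c),m^* )}+\delta_{(-m^*,-m(c),-m^* )}\right).$$ (2) If $\lim_{N\to\infty}\alpha_N\sqrt{b_NN}=C$ for some constant $C\in(0,\infty)$, then the distribution of $m$ under the Gibbs measure converges weakly to $$\sum_{\chi_1,\chi_2,\chi_3\in\{-1,+1\}}a(\chi_1,\chi_2,\chi_3,C)\,\delta_{(\chi_1m^*,\chi_2m^*,\chi_3m^* )},$$ where $$a(\chi_1,\chi_2,\chi_3,C)=\begin{cases}\dfrac{1}{2\left(1+e^{-\sqrt2C(m^* )^2}\right)^2}&\text{if }\chi_1=\chi_2=\chi_3,\\[2ex]\dfrac{e^{-2\sqrt2C(m^* )^2}}{2\left(1+e^{-\sqrt2C(m^* )^2}\right)^2}&\text{if }\chi_1=\chi_3=-\chi_2,\\[2ex]\dfrac{e^{-\sqrt2C(m^* )^2}}{2\left(1+e^{-\sqrt2C(m^* )^2}\right)^2}&\text{if }\chi_1=-\chi_3\ (\text{and }\chi_2\text{ arbitrary}).\end{cases}$$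
   Context: Let $(b_N)_N\subset\mathbb N$ be a non-decreasing sequence with $b_N\to\infty$ and $b_N/N\to0$; $N$ tends to infinity along those values for which $N-b_N$ is even. The set $\{1,\dots,N\}$ is partitioned into blocks $B_1,B_2,B_3$ with $|B_2|=b_N$ and $|B_1|=|B_3|=\frac{N-b_N}{2}$. For $\sigma\in\{-1,+1\}^N$ let $m_k=\frac1{|B_k|}\sum_{i\in B_k}\sigma_i$ and $$H_{N,\beta,\alpha_N}(\sigma)=-\sum_{k=1}^3\frac{\beta}{2}|B_k|m_k^2-\alpha_N\sqrt{|B_1||B_2|}\,m_1m_2-\alpha_N\sqrt{|B_3||B_2|}\,m_3m_2 .$$ The Gibbs measure on $\{-1,+1\}^N$ is $\mu_{N,\beta,\alpha_N}(\sigma)=\frac1{Z_{N,\beta,\alpha_N}}e^{-H_{N,\beta,\alpha_N}(\sigma)}2^{-N}$, with $Z_{N,\beta,\alpha_N}$ the normalizing constant. $m^*=m^*(\beta)$ denotes the largest solution of $x=\tanh(\beta x)$, and for $c\in[0,\infty)$, $m(c)$ denotes the largest solution of $x=\tanh(\beta x+\sqrt2\,c\,m^* )$. *)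

theory Defs
  imports "HOL-Probability.Probability"
begin

text \<open>\<open>N\<close> tends to infinity along the values for which a partition with the prescribed block sizes
  exists. The condition \<open>b N \<le> N\<close> holds for all large \<open>N\<close>; it is made explicit because
  subtraction on \<open>nat\<close> truncates.\<close>

definition admissible :: "(nat \<Rightarrow> nat) \<Rightarrow> nat set" where
  "admissible b = {N. b N \<le> N \<and> even (N - b N)}"

definition adm_at_top :: "(nat \<Rightarrow> nat) \<Rightarrow> nat filter" where
  "adm_at_top b = inf at_top (principal (admissible b))"

definition three_block_partition :: "nat \<Rightarrow> nat \<Rightarrow> (nat \<Rightarrow> nat set) \<Rightarrow> bool" where
  "three_block_partition N bN B \<longleftrightarrow>
     (\<Union>k\<in>{1..3}. B k) = {1..N} \<and> disjoint_family_on B {1..3} \<and>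
     card (B 2) = bN \<and>
     real (card (B 1)) = (real N - real bN) / 2 \<and>
     real (card (B 3)) = (real N - real bN) / 2"

definition spins :: "nat \<Rightarrow> (nat \<Rightarrow> real) set" where
  "spins N = {1..N} \<rightarrow>\<^sub>E {-1, 1}"

definition block_mag :: "(nat \<Rightarrow> nat set) \<Rightarrow> (nat \<Rightarrow> real) \<Rightarrow> nat \<Rightarrow> real" where
  "block_mag B \<sigma> k = (\<Sum>i\<in>B k. \<sigma> i) / real (card (B k))"

definition mag_vector :: "(nat \<Rightarrow> nat set) \<Rightarrow> (nat \<Rightarrow> real) \<Rightarrow> real \<times> real \<times> real" where
  "mag_vector B \<sigma> = (block_mag B \<sigma> 1, block_mag B \<sigma> 2, block_mag B \<sigma> 3)"

definition hamiltonian :: "(nat \<Rightarrow> nat set) \<Rightarrow> real \<Rightarrow> real \<Rightarrow> (nat \<Rightarrow> real) \<Rightarrow> real" where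
  "hamiltonian B \<beta> \<alpha> \<sigma> =
     - (\<Sum>k=1..3. \<beta> / 2 * real (card (B k)) * (block_mag B \<sigma> k)\<^sup>2)
     - \<alpha> * sqrt (real (card (B 1)) * real (card (B 2))) * block_mag B \<sigma> 1 * block_mag B \<sigma> 2
     - \<alpha> * sqrt (real (card (B 3)) * real (card (B 2))) * block_mag B \<sigma> 3 * block_mag B \<sigma> 2"

definition partition_function :: "nat \<Rightarrow> (nat \<Rightarrow> nat set) \<Rightarrow> real \<Rightarrow> real \<Rightarrow> real" where
  "partition_function N B \<beta> \<alpha> = (\<Sum>\<sigma>\<in>spins N. exp (- hamiltonian B \<beta> \<alpha> \<sigma>) / 2 ^ N)"

definition gibbs :: "nat \<Rightarrow> (nat \<Rightarrow> nat set) \<Rightarrow> real \<Rightarrow> real \<Rightarrow> (nat \<Rightarrow> real) measure" where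
  "gibbs N B \<beta> \<alpha> = point_measure (spins N)
     (\<lambda>\<sigma>. ennreal (1 / partition_function N B \<beta> \<alpha> * (exp (- hamiltonian B \<beta> \<alpha> \<sigma>) / 2 ^ N)))"

definition mag_distr :: "nat \<Rightarrow> (nat \<Rightarrow> nat set) \<Rightarrow> real \<Rightarrow> real \<Rightarrow> (real \<times> real \<times> real) measure" where
  "mag_distr N B \<beta> \<alpha> = distr (gibbs N B \<beta> \<alpha>) borel (mag_vector B)"

definition m_star :: "real \<Rightarrow> real" where
  "m_star \<beta> = (GREATEST x. x = tanh (\<beta> * x))"

definition m_field :: "real \<Rightarrow> real \<Rightarrow> real" where
  "m_field \<beta> c = (GREATEST x. x = tanh (\<beta> * x + sqrt 2 * c * m_star \<beta>))"

definition weight_a :: "real \<Rightarrow> real \<times> real \<times> real \<Rightarrow> real \<Rightarrow> real" where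
  "weight_a \<beta> = (\<lambda>(\<chi>1, \<chi>2, \<chi>3) C.
     if \<chi>1 = \<chi>2 \<and> \<chi>2 = \<chi>3 then
       1 / (2 * (1 + exp (- sqrt 2 * C * (m_star \<beta>)\<^sup>2))\<^sup>2)
     else if \<chi>1 = \<chi>3 \<and> \<chi>3 = - \<chi>2 then
       exp (- 2 * sqrt 2 * C * (m_star \<beta>)\<^sup>2) / (2 * (1 + exp (- sqrt 2 * C * (m_star \<beta>)\<^sup>2))\<^sup>2)
     else
       exp (- sqrt 2 * C * (m_star \<beta>)\<^sup>2) / (2 * (1 + exp (- sqrt 2 * C * (m_star \<beta>)\<^sup>2))\<^sup>2))"

text \<open>For finite \<open>I\<close> and nonnegative weights, \<open>dirac_mixture I w x\<close> is the Borel measure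
  \<open>\<Sum>i\<in>I. w i \<cdot> \<delta>(x i)\<close>; see \<open>emeasure_dirac_mixture\<close>. (Measures do not form an
  additive monoid type in the library, so the sum cannot be written with \<open>\<Sum>\<close>.)\<close>

definition dirac_mixture :: "'i set \<Rightarrow> ('i \<Rightarrow> real) \<Rightarrow> ('i \<Rightarrow> 'a::topological_space) \<Rightarrow> 'a measure" where
  "dirac_mixture I w x = distr (point_measure I (\<lambda>i. ennreal (w i))) borel x"

lemma emeasure_dirac_mixture:
  assumes "finite I" "A \<in> sets borel"
  shows "emeasure (dirac_mixture I w x) A =
           (\<Sum>i\<in>I. ennreal (w i) * emeasure (return borel (x i)) A)"
proof -
  have meas: "x \<in> measurable (point_measure I (\<lambda>i. ennreal (w i))) borel"
    by (simp add: point_measure_def)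
  have "emeasure (dirac_mixture I w x) A =
      emeasure (point_measure I (\<lambda>i. ennreal (w i))) (x -` A \<inter> I)"
    unfolding dirac_mixture_def using assms meas
    by (simp add: emeasure_distr space_point_measure)
  also have "\<dots> = (\<Sum>i\<in>x -` A \<inter> I. ennreal (w i))"
    using assms by (subst emeasure_point_measure_finite) auto
  also have "\<dots> = (\<Sum>i\<in>I. ennreal (w i) * indicator A (x i))"
    using assms(1) by (intro sum.mono_neutral_cong_left) (auto simp: indicator_def)
  finally show ?thesis
    using assms(2) by simp
qed

lemma finite_spins: "finite (spins N)"
  by (simp add: spins_def finite_PiE)

lemma prob_space_gibbs: "prob_space (gibbs N B \<beta> \<alpha>)"
proof
  have ne: "spins N \<noteq> {}"
    by (simp add: spins_def PiE_eq_empty_iff)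
  have pos: "partition_function N B \<beta> \<alpha> > 0"
    unfolding partition_function_def using finite_spins ne by (intro sum_pos) auto
  have "emeasure (gibbs N B \<beta> \<alpha>) (space (gibbs N B \<beta> \<alpha>)) =
      (\<Sum>\<sigma>\<in>spins N. ennreal (1 / partition_function N B \<beta> \<alpha> * (exp (- hamiltonian B \<beta> \<alpha> \<sigma>) / 2 ^ N)))"
    unfolding gibbs_def space_point_measure
    using finite_spins by (subst emeasure_point_measure_finite) auto
  also have "\<dots> = ennreal (\<Sum>\<sigma>\<in>spins N. 1 / partition_function N B \<beta> \<alpha> * (exp (- hamiltonian B \<beta> \<alpha> \<sigma>) / 2 ^ N))"
    using pos by (intro sum_ennreal) simp
  also have "(\<Sum>\<sigma>\<in>spins N. 1 / partition_function N B \<beta> \<alpha> * (exp (- hamiltonian B \<beta> \<alpha> \<sigma>) / 2 ^ N)) = 1"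
    unfolding sum_distrib_left[symmetric] using pos by (simp add: partition_function_def)
  finally show "emeasure (gibbs N B \<beta> \<alpha>) (space (gibbs N B \<beta> \<alpha>)) = 1"
    by simp
qed

text \<open>Weak convergence of Borel measures along a filter, tested against bounded continuous
  functions; the library's \<open>weak_conv_m\<close> only covers sequences of measures on the real line.\<close>

definition weakly_converges :: "('b \<Rightarrow> 'a::topological_space measure) \<Rightarrow> 'a measure \<Rightarrow> 'b filter \<Rightarrow> bool" where
  "weakly_converges M L F \<longleftrightarrow>
     (\<forall>f :: 'a \<Rightarrow> real. continuous_on UNIV f \<and> bounded (range f) \<longrightarrow>
        ((\<lambda>n. integral\<^sup>L (M n) f) \<longlongrightarrow> integral\<^sup>L L f) F)"

end

theory Submission
  imports Defs
begin

text \<open>Everything reduces to a single Curie-Weiss block, because the three blocks are independent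
  Curie-Weiss models up to the factor \<open>exp (a * m2 * (m1 + m3))\<close> with
  \<open>a = \<alpha> * sqrt (|B1| * |B2|)\<close> (\<open>integral_mag_distr\<close>).

  \<^bold>\<open>One block.\<close> The exponent \<open>\<beta>/2 m\<^sup>2 + h m\<close> equals its tangent line at any point \<open>x\<close> plus
  \<open>\<beta>/2 (m - x)\<^sup>2\<close>, and the exponential moments of a sum of independent signs are powers of \<open>cosh\<close>. Dropping
  the square bounds the partition function from below by \<open>2^n exp (n \<psi>(x))\<close> for every \<open>x\<close>, where
  \<open>\<psi>(x) = ln (cosh (\<beta> x + h)) - \<beta>/2 x\<^sup>2\<close>; near \<open>x\<close> the square is small, so almost the same quantity
  bounds the contribution of a small interval around \<open>x\<close> from above. A finite cover then shows that a
  compact set on which \<open>\<psi>\<close> stays below its maximum has exponentially small probability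
  (\<open>curie_weiss_exponentially_small\<close>). The
  critical points of \<open>\<psi>\<close> are the solutions of \<open>x = tanh (\<beta> x + h)\<close>, and concavity of \<open>tanh\<close> on the
  positive axis identifies the maximizers: \<open>\<plusminus>m*\<close> without a field, and the largest solution alone when
  \<open>h > 0\<close> (\<open>free_energy_less_max\<close>, \<open>free_energy_less_abs\<close>).

  \<^bold>\<open>Bounded coupling.\<close> If \<open>\<alpha> sqrt (b N) \<rightarrow> C\<close>, then \<open>a \<rightarrow> C / sqrt 2\<close>, so the Gibbs measure has a
  uniformly convergent, bounded density with respect to the independent model. There every \<open>|m_k|\<close>
  concentrates at \<open>m*\<close>, and flipping the blocks separately is a symmetry, so the eight sign patterns are
  equally likely before the density reweights them
  (\<open>block_gibbs_tendsto_bounded_coupling\<close>).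

  \<^bold>\<open>Strong coupling.\<close> If \<open>\<alpha> sqrt (N / b) \<rightarrow> c\<close>, then \<open>a\<close> is of the order of \<open>|B2|\<close>, and the scales
  \<open>|B2|\<close> and \<open>|B1|\<close> separate. The coupling changes probabilities by at most a factor
  \<open>exp (4 a)\<close>, which cannot undo the concentration of \<open>|m1|\<close> and \<open>|m3|\<close> at the much larger scale \<open>|B1|\<close>. If \<open>m1\<close> and \<open>m3\<close> have opposite
  signs, they nearly cancel and the exponent of the coupling is at most a small multiple of \<open>a\<close>, whereas
  the normalization grows like the exponential of a fixed multiple of \<open>a\<close>. If they have a common
  sign, the middle block feels a field close to \<open>\<plusminus>sqrt 2 c m*\<close> and concentrates at
  \<open>\<plusminus>m(c)\<close>. The global spin flip gives the two remaining points equal weight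
  (\<open>block_gibbs_tendsto_strong_coupling\<close>).\<close>

section \<open>Weighted means over finite sets\<close>

definition wmean :: "'s set \<Rightarrow> ('s \<Rightarrow> real) \<Rightarrow> ('s \<Rightarrow> real) \<Rightarrow> real" where
  "wmean S w f = (\<Sum>s\<in>S. w s * f s) / (\<Sum>s\<in>S. w s)"

definition weighted :: "'s set \<Rightarrow> ('s \<Rightarrow> real) \<Rightarrow> bool" where
  "weighted S w \<longleftrightarrow> finite S \<and> S \<noteq> {} \<and> (\<forall>s\<in>S. 0 < w s)"

lemma weighted_sum_pos: "weighted S w \<Longrightarrow> 0 < (\<Sum>s\<in>S. w s)"
  unfolding weighted_def by (intro sum_pos) auto

lemma wmean_mono:
  assumes "weighted S w" "\<And>s. s \<in> S \<Longrightarrow> f s \<le> g s"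
  shows "wmean S w f \<le> wmean S w g"
  unfolding wmean_def using assms weighted_sum_pos[OF assms(1)]
  by (intro divide_right_mono sum_mono mult_left_mono) (auto simp: weighted_def intro: less_imp_le)

lemma wmean_const [simp]: "weighted S w \<Longrightarrow> wmean S w (\<lambda>_. c) = c"
  using weighted_sum_pos[of S w] by (simp add: wmean_def flip: sum_distrib_right)

lemma wmean_add: "wmean S w (\<lambda>s. f s + g s) = wmean S w f + wmean S w g"
  by (simp add: wmean_def distrib_left sum.distrib add_divide_distrib)

lemma wmean_cmult: "wmean S w (\<lambda>s. c * f s) = c * wmean S w f"
  by (simp add: wmean_def sum_distrib_left mult.left_commute)

lemma wmean_diff: "wmean S w (\<lambda>s. f s - g s) = wmean S w f - wmean S w g"
  by (simp add: wmean_def right_diff_distrib sum_subtractf diff_divide_distrib)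

lemma wmean_pos:
  assumes "weighted S w" "\<And>s. s \<in> S \<Longrightarrow> 0 < f s"
  shows "0 < wmean S w f"
  unfolding wmean_def using assms weighted_sum_pos[OF assms(1)]
  by (intro divide_pos_pos sum_pos) (auto simp: weighted_def)

text \<open>Multiplying the weights by \<open>t\<close> is a change of measure with unnormalized density \<open>t\<close>.\<close>

lemma wmean_tilt:
  assumes "weighted S w"
  shows "wmean S (\<lambda>s. w s * t s) f = wmean S w (\<lambda>s. t s * f s) / wmean S w t"
  using weighted_sum_pos[OF assms] by (simp add: wmean_def mult.assoc)

lemma wmean_bij:
  assumes "bij_betw g T S"
  shows "wmean S w f = wmean T (\<lambda>t. w (g t)) (\<lambda>t. f (g t))"
  unfolding wmean_def by (simp add: sum.reindex_bij_betw[OF assms, symmetric])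

lemma wmean_times:
  "wmean (S \<times> T) (\<lambda>(s, t). u s * v t) F = wmean S u (\<lambda>s. wmean T v (\<lambda>t. F (s, t)))"
proof -
  have "(\<Sum>p\<in>S \<times> T. (case p of (s, t) \<Rightarrow> u s * v t) * F p) =
      (\<Sum>s\<in>S. u s * (\<Sum>t\<in>T. v t * F (s, t)))"
    by (simp add: sum.cartesian_product sum_distrib_left mult.assoc split_beta)
  moreover have "(\<Sum>p\<in>S \<times> T. (case p of (s, t) \<Rightarrow> u s * v t)) = (\<Sum>s\<in>S. u s) * (\<Sum>t\<in>T. v t)"
    by (simp add: sum.cartesian_product sum_product split_beta)
  ultimately show ?thesis
    by (simp only: wmean_def times_divide_eq_right sum_divide_distrib[symmetric] divide_divide_eq_left mult.commute)
qed

text \<open>If all mass concentrates near the finite set \<open>P\<close>, only the values of \<open>G\<close> on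
  \<open>P\<close> survive; assuming one common value there makes it unnecessary to know how the mass is
  shared among the points of \<open>P\<close>. Both regimes are brought into this form by averaging the test
  function over a symmetry group of the model.\<close>

lemma wmean_concentrated:
  fixes X :: "'n \<Rightarrow> 's \<Rightarrow> 'a::metric_space"
  assumes weighted: "\<forall>\<^sub>F n in F. weighted (S n) (w n)"
    and P: "finite P"
    and conc: "\<And>d. d > 0 \<Longrightarrow>
      ((\<lambda>n. wmean (S n) (w n) (\<lambda>s. of_bool (\<forall>p\<in>P. d \<le> dist (X n s) p))) \<longlongrightarrow> 0) F"
    and G: "\<And>p. p \<in> P \<Longrightarrow> isCont G p" "\<And>p. p \<in> P \<Longrightarrow> G p = (g::real)"
    and bound: "\<And>n s. s \<in> S n \<Longrightarrow> \<bar>G (X n s)\<bar> \<le> K"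
  shows "((\<lambda>n. wmean (S n) (w n) (\<lambda>s. G (X n s))) \<longlongrightarrow> g) F"
proof (rule tendstoI)
  fix e :: real assume "e > 0"
  have "\<exists>d>0. \<forall>y. dist y p < d \<longrightarrow> \<bar>G y - g\<bar> < e / 2" if "p \<in> P" for p
    using G[OF that] \<open>e > 0\<close> unfolding continuous_at_eps_delta dist_real_def
    by (metis half_gt_zero)
  then obtain dd where dd: "\<And>p. p \<in> P \<Longrightarrow> dd p > 0"
      "\<And>p y. p \<in> P \<Longrightarrow> dist y p < dd p \<Longrightarrow> \<bar>G y - g\<bar> < e / 2"
    by metis
  define d where "d = Min (insert 1 (dd ` P))"
  have "d > 0" unfolding d_def using P dd by auto
  have d: "\<bar>G y - g\<bar> < e / 2" if "p \<in> P" "dist y p < d" for p y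
    using that dd(2)[of p y] P unfolding d_def by auto
  define L where "L = \<bar>K\<bar> + \<bar>g\<bar> + 1"
  have "\<forall>\<^sub>F n in F. wmean (S n) (w n) (\<lambda>s. of_bool (\<forall>p\<in>P. d \<le> dist (X n s) p)) < e / (2 * L)"
    using conc[OF \<open>d > 0\<close>] by (rule order_tendstoD) (use \<open>e > 0\<close> in \<open>simp add: L_def\<close>)
  then show "\<forall>\<^sub>F n in F. dist (wmean (S n) (w n) (\<lambda>s. G (X n s))) g < e"
    using weighted
  proof eventually_elim
    case (elim n)
    let ?bad = "\<lambda>s. of_bool (\<forall>p\<in>P. d \<le> dist (X n s) p)"
    have pt: "\<bar>G (X n s) - g\<bar> \<le> e / 2 + L * ?bad s" if "s \<in> S n" for s
    proof (cases "\<forall>p\<in>P. d \<le> dist (X n s) p")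
      case True
      then show ?thesis using bound[OF that] \<open>e > 0\<close> by (auto simp: L_def)
    next
      case False
      then obtain p where "p \<in> P" "dist (X n s) p < d" by (auto simp: not_le)
      then have "\<bar>G (X n s) - g\<bar> < e / 2" by (rule d)
      moreover have "?bad s = (0::real)" using False by simp
      ultimately show ?thesis by (simp only: mult_zero_right add_0_right less_imp_le)
    qed
    have "wmean (S n) (w n) (\<lambda>s. G (X n s) - g) \<le> wmean (S n) (w n) (\<lambda>s. e / 2 + L * ?bad s)"
      by (intro wmean_mono[OF elim(2)]) (metis pt abs_le_D1)
    moreover have "wmean (S n) (w n) (\<lambda>s. - 1 * (e / 2 + L * ?bad s)) \<le> wmean (S n) (w n) (\<lambda>s. G (X n s) - g)"
    proof (intro wmean_mono[OF elim(2)])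
      fix s assume "s \<in> S n"
      from abs_le_D2[OF pt[OF this]] show "- 1 * (e / 2 + L * ?bad s) \<le> G (X n s) - g"
        by (simp add: field_simps)
    qed
    moreover have "L * wmean (S n) (w n) ?bad < e / 2"
      using elim(1) by (simp add: L_def field_simps)
    ultimately show ?case
      unfolding wmean_cmult wmean_add wmean_diff using elim(2) by (simp add: dist_real_def)
  qed
qed

section \<open>A single Curie-Weiss block\<close>

definition signs :: "'i set \<Rightarrow> ('i \<Rightarrow> real) set" where
  "signs A = A \<rightarrow>\<^sub>E {-1, 1}"

definition mean_spin :: "'i set \<Rightarrow> ('i \<Rightarrow> real) \<Rightarrow> real" where
  "mean_spin A \<sigma> = (\<Sum>i\<in>A. \<sigma> i) / real (card A)"

lemma finite_signs: "finite A \<Longrightarrow> finite (signs A)"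
  by (simp add: signs_def finite_PiE)

lemma signs_nonempty: "signs A \<noteq> {}"
  by (simp add: signs_def PiE_eq_empty_iff)

lemma abs_mean_spin_le_1:
  assumes "\<sigma> \<in> signs A"
  shows "\<bar>mean_spin A \<sigma>\<bar> \<le> 1"
proof (cases "finite A \<and> A \<noteq> {}")
  case True
  have "\<bar>\<Sum>i\<in>A. \<sigma> i\<bar> \<le> (\<Sum>i\<in>A. \<bar>\<sigma> i\<bar>)" by (rule sum_abs)
  also have "\<dots> \<le> (\<Sum>i\<in>A. 1)"
    using assms by (intro sum_mono) (force simp: signs_def PiE_iff)
  finally show ?thesis using True by (simp add: mean_spin_def field_simps card_gt_0_iff)
qed (auto simp: mean_spin_def)

lemma card_mult_mean_spin: "finite A \<Longrightarrow> real (card A) * mean_spin A \<sigma> = (\<Sum>i\<in>A. \<sigma> i)"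
  by (cases "A = {}") (auto simp: mean_spin_def)

text \<open>The spins are independent under the uniform distribution, so the moment generating function factorizes.\<close>

lemma sum_signs_exp:
  assumes "finite A"
  shows "(\<Sum>\<sigma>\<in>signs A. exp (real (card A) * (t * mean_spin A \<sigma>))) = (2 * cosh t) ^ card A"
proof -
  have "(\<Sum>\<sigma>\<in>signs A. exp (real (card A) * (t * mean_spin A \<sigma>))) = (\<Sum>\<sigma>\<in>signs A. \<Prod>i\<in>A. exp (t * \<sigma> i))"
  proof (intro sum.cong refl)
    fix \<sigma> :: "'a \<Rightarrow> real"
    have "real (card A) * (t * mean_spin A \<sigma>) = (\<Sum>i\<in>A. t * \<sigma> i)"
      using card_mult_mean_spin[OF assms, of \<sigma>] by (simp add: mult.left_commute sum_distrib_left)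
    then show "exp (real (card A) * (t * mean_spin A \<sigma>)) = (\<Prod>i\<in>A. exp (t * \<sigma> i))"
      using assms by (simp add: exp_sum)
  qed
  also have "\<dots> = (\<Prod>i\<in>A. \<Sum>s\<in>{-1, 1}. exp (t * s))"
    unfolding signs_def using assms by (intro prod_sum_PiE[symmetric]) auto
  also have "(\<Sum>s\<in>{-1, 1}. exp (t * s)) = 2 * cosh t"
    by (simp add: cosh_def)
  finally show ?thesis by simp
qed

definition curie_weiss_weight :: "real \<Rightarrow> real \<Rightarrow> 'i set \<Rightarrow> ('i \<Rightarrow> real) \<Rightarrow> real" where
  "curie_weiss_weight \<beta> h A \<sigma> = exp (real (card A) * (\<beta> / 2 * (mean_spin A \<sigma>)\<^sup>2 + h * mean_spin A \<sigma>))"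

text \<open>Expectation of a function of the magnetization in the Curie-Weiss model on \<open>A\<close> at inverse
  temperature \<open>\<beta>\<close> in the external field \<open>h\<close>.\<close>

definition curie_weiss :: "real \<Rightarrow> real \<Rightarrow> 'i set \<Rightarrow> (real \<Rightarrow> real) \<Rightarrow> real" where
  "curie_weiss \<beta> h A f = wmean (signs A) (curie_weiss_weight \<beta> h A) (\<lambda>\<sigma>. f (mean_spin A \<sigma>))"

lemma weighted_curie_weiss: "finite A \<Longrightarrow> weighted (signs A) (curie_weiss_weight \<beta> h A)"
  by (simp add: weighted_def finite_signs signs_nonempty curie_weiss_weight_def)

text \<open>The function whose maximum over \<open>x\<close> is the limiting free energy per spin. It is the
  Hubbard-Stratonovich form of \<open>\<beta>/2 x\<^sup>2 + h x - I(x)\<close>, where \<open>I\<close> is the large deviation rate function of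
  the mean of fair signs: the two functions have the same critical points and the same values there.\<close>

definition free_energy :: "real \<Rightarrow> real \<Rightarrow> real \<Rightarrow> real" where
  "free_energy \<beta> h x = ln (cosh (\<beta> * x + h)) - \<beta> / 2 * x\<^sup>2"

text \<open>This exact expansion at \<open>x\<close> serves for both bounds on sums of weights: its linear part can be summed
  explicitly over all configurations, and its remainder has a sign and is small near \<open>x\<close>.\<close>

lemma curie_weiss_exponent_linearized:
  "(\<beta>::real) / 2 * m\<^sup>2 + h * m = - (\<beta> / 2 * x\<^sup>2) + (\<beta> * x + h) * m + \<beta> / 2 * (m - x)\<^sup>2"
  by (simp add: power2_eq_square field_simps)

lemma exp_free_energy:
  "exp (real n * free_energy \<beta> h x) = exp (real n * - (\<beta> / 2 * x\<^sup>2)) * cosh (\<beta> * x + h) ^ n"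
proof -
  have "exp (real n * free_energy \<beta> h x) = exp (real n * - (\<beta> / 2 * x\<^sup>2)) * exp (real n * ln (cosh (\<beta> * x + h)))"
    by (simp add: free_energy_def algebra_simps flip: exp_add)
  also have "exp (real n * ln (cosh (\<beta> * x + h))) = cosh (\<beta> * x + h) ^ n"
    by (simp add: exp_of_nat_mult)
  finally show ?thesis .
qed

lemma sum_signs_linearized:
  assumes "finite A"
  shows "(\<Sum>\<sigma>\<in>signs A. exp (real (card A) * (- (\<beta> / 2 * x\<^sup>2) + (\<beta> * x + h) * mean_spin A \<sigma>))) =
    2 ^ card A * exp (real (card A) * free_energy \<beta> h x)"
  unfolding distrib_left exp_add sum_distrib_left[symmetric] sum_signs_exp[OF assms] exp_free_energy
  by (simp add: power_mult_distrib)

lemma curie_weiss_partition_lower: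
  assumes "finite A" "0 \<le> \<beta>"
  shows "2 ^ card A * exp (real (card A) * free_energy \<beta> h x) \<le> (\<Sum>\<sigma>\<in>signs A. curie_weiss_weight \<beta> h A \<sigma>)"
  unfolding sum_signs_linearized[OF assms(1), symmetric] curie_weiss_weight_def
proof (intro sum_mono iffD2[OF exp_le_cancel_iff] mult_left_mono)
  fix \<sigma> :: "'a \<Rightarrow> real"
  have "0 \<le> \<beta> / 2 * (mean_spin A \<sigma> - x)\<^sup>2" using assms(2) by simp
  then show "- (\<beta> / 2 * x\<^sup>2) + (\<beta> * x + h) * mean_spin A \<sigma> \<le> \<beta> / 2 * (mean_spin A \<sigma>)\<^sup>2 + h * mean_spin A \<sigma>"
    unfolding curie_weiss_exponent_linearized[of \<beta> _ h x] by linarith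
qed simp

text \<open>Around each point of \<open>F\<close> the linearized sum is an upper bound up to a factor \<open>exp (n \<delta>)\<close>, and \<open>F\<close> is
  covered by finitely many such neighbourhoods; \<open>curie_weiss_partition_lower\<close> at \<open>x0\<close> bounds the
  normalization. The constants depend on \<open>F\<close> but not on the size of the block.\<close>

lemma curie_weiss_exponentially_small:
  assumes "0 < \<beta>" and F: "compact F" and less: "\<And>x. x \<in> F \<Longrightarrow> free_energy \<beta> h x < free_energy \<beta> h x0"
  obtains K \<delta> where "0 < K" "0 < \<delta>"
    "\<And>A :: 'i set. finite A \<Longrightarrow> curie_weiss \<beta> h A (\<lambda>x. of_bool (x \<in> F)) \<le> K * exp (- \<delta> * real (card A))"
proof -
  have cont: "continuous_on F (free_energy \<beta> h)"
    unfolding free_energy_def[abs_def] by (intro continuous_intros) auto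
  obtain \<delta> where \<delta>: "0 < \<delta>" "\<And>x. x \<in> F \<Longrightarrow> free_energy \<beta> h x + 2 * \<delta> \<le> free_energy \<beta> h x0"
  proof (cases "F = {}")
    case False
    then obtain y where y: "y \<in> F" "\<And>x. x \<in> F \<Longrightarrow> free_energy \<beta> h x \<le> free_energy \<beta> h y"
      using continuous_attains_sup[OF F _ cont] by blast
    show ?thesis
    proof (rule that[of "(free_energy \<beta> h x0 - free_energy \<beta> h y) / 2"])
      show "0 < (free_energy \<beta> h x0 - free_energy \<beta> h y) / 2" using less[OF y(1)] by simp
    qed (use y(2) in \<open>simp add: field_simps\<close>)
  qed (use that[of 1] in simp)
  \<comment> \<open>The radius at which the quadratic remainder costs exactly half of the gap \<open>2 * \<delta>\<close>.\<close>
  define r where "r = sqrt (2 * \<delta> / \<beta>)"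
  have "r > 0" and r: "\<beta> / 2 * r\<^sup>2 = \<delta>"
    using \<delta>(1) assms(1) by (simp_all add: r_def)
  obtain T where T: "finite T" "T \<subseteq> F" "F \<subseteq> (\<Union>x\<in>T. ball x r)"
    using compactE_image[OF F, of F "\<lambda>x. ball x r"] \<open>r > 0\<close> by force
  have "curie_weiss \<beta> h A (\<lambda>x. of_bool (x \<in> F)) \<le> (real (card T) + 1) * exp (- \<delta> * real (card A))"
    if A: "finite A" for A :: "'i set"
  proof -
    let ?n = "real (card A)"
    let ?lin = "\<lambda>x \<sigma>. - (\<beta> / 2 * x\<^sup>2) + (\<beta> * x + h) * mean_spin A \<sigma>"
    have pt: "curie_weiss_weight \<beta> h A \<sigma> * of_bool (mean_spin A \<sigma> \<in> F) \<le> (\<Sum>x\<in>T. exp (?n * \<delta>) * exp (?n * ?lin x \<sigma>))" for \<sigma>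
    proof (cases "mean_spin A \<sigma> \<in> F")
      case True
      then obtain x where x: "x \<in> T" "\<bar>mean_spin A \<sigma> - x\<bar> < r"
        using T(3) by (force simp: dist_real_def)
      have "(mean_spin A \<sigma> - x)\<^sup>2 \<le> r\<^sup>2"
        using x(2) by (intro abs_le_square_iff[THEN iffD1]) auto
      then have "\<beta> / 2 * (mean_spin A \<sigma> - x)\<^sup>2 \<le> \<delta>"
        using assms(1) r by (metis mult_left_mono less_imp_le half_gt_zero)
      then have "curie_weiss_weight \<beta> h A \<sigma> \<le> exp (?n * (\<delta> + ?lin x \<sigma>))"
        unfolding curie_weiss_weight_def curie_weiss_exponent_linearized[of \<beta> _ h x]
        by (intro iffD2[OF exp_le_cancel_iff] mult_left_mono) linarith+
      also have "\<dots> = exp (?n * \<delta>) * exp (?n * ?lin x \<sigma>)"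
        by (simp only: distrib_left exp_add)
      also have "\<dots> \<le> (\<Sum>x\<in>T. exp (?n * \<delta>) * exp (?n * ?lin x \<sigma>))"
        using T(1) x(1) by (intro member_le_sum) auto
      finally show ?thesis using True by simp
    qed (simp add: sum_nonneg)
    have "(\<Sum>\<sigma>\<in>signs A. curie_weiss_weight \<beta> h A \<sigma> * of_bool (mean_spin A \<sigma> \<in> F)) \<le>
        (\<Sum>\<sigma>\<in>signs A. \<Sum>x\<in>T. exp (?n * \<delta>) * exp (?n * ?lin x \<sigma>))"
      by (intro sum_mono pt)
    also have "\<dots> = (\<Sum>x\<in>T. exp (?n * \<delta>) * (2 ^ card A * exp (?n * free_energy \<beta> h x)))"
      by (subst sum.swap) (simp only: sum_distrib_left[symmetric] sum_signs_linearized[OF A])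
    also have "\<dots> \<le> (\<Sum>x\<in>T. exp (- \<delta> * ?n) * (2 ^ card A * exp (?n * free_energy \<beta> h x0)))"
    proof (intro sum_mono)
      fix x assume "x \<in> T"
      then have "?n * (free_energy \<beta> h x + 2 * \<delta>) \<le> ?n * free_energy \<beta> h x0"
        using \<delta>(2) T(2) by (intro mult_left_mono) auto
      then have "exp (?n * \<delta>) * exp (?n * free_energy \<beta> h x) \<le> exp (- \<delta> * ?n) * exp (?n * free_energy \<beta> h x0)"
        unfolding exp_add[symmetric] by (simp add: algebra_simps)
      then show "exp (?n * \<delta>) * (2 ^ card A * exp (?n * free_energy \<beta> h x)) \<le>
          exp (- \<delta> * ?n) * (2 ^ card A * exp (?n * free_energy \<beta> h x0))"
        by (simp add: mult.left_commute)
    qed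
    also have "\<dots> = real (card T) * exp (- \<delta> * ?n) * (2 ^ card A * exp (?n * free_energy \<beta> h x0))"
      by simp
    also have "\<dots> \<le> real (card T) * exp (- \<delta> * ?n) * (\<Sum>\<sigma>\<in>signs A. curie_weiss_weight \<beta> h A \<sigma>)"
      using A assms(1) by (intro mult_left_mono curie_weiss_partition_lower) auto
    finally have "curie_weiss \<beta> h A (\<lambda>x. of_bool (x \<in> F)) \<le> real (card T) * exp (- \<delta> * ?n)"
      using weighted_sum_pos[OF weighted_curie_weiss[OF A], of \<beta> h]
      by (simp add: curie_weiss_def wmean_def pos_divide_le_eq)
    then show ?thesis by (simp add: distrib_right) (smt (verit) exp_gt_zero)
  qed
  then show ?thesis using \<delta>(1) by (intro that[of "real (card T) + 1" \<delta>]) auto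
qed

section \<open>Maximizers of the free energy\<close>

lemma has_field_derivative_mean_field:
  "((\<lambda>x. tanh (\<beta> * x + h) - x) has_field_derivative \<beta> * (1 - (tanh (\<beta> * x + h))\<^sup>2) - 1) (at (x::real))"
  by (auto intro!: derivative_eq_intros simp: mult.commute)

lemma has_field_derivative_free_energy:
  "(free_energy \<beta> h has_field_derivative \<beta> * (tanh (\<beta> * x + h) - x)) (at x)"
  unfolding free_energy_def[abs_def]
  by (auto intro!: derivative_eq_intros simp: tanh_def field_simps)

text \<open>Above a point where \<open>tanh (\<beta> x + h)\<close> exceeds \<open>x\<close> there is a solution, since \<open>tanh < 1\<close>. This gives a
  positive solution and shows that the graph stays below the diagonal beyond the last one. The
  starting point near \<open>0\<close> comes from the field if \<open>h > 0\<close>, and from the slope \<open>\<beta> > 1\<close> at \<open>0\<close> if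
  \<open>h = 0\<close>.\<close>

lemma greatest_mean_field_root:
  fixes \<beta> h :: real
  assumes "0 < \<beta>" "0 \<le> h" "1 < \<beta> \<or> 0 < h"
  defines "m \<equiv> (GREATEST x. x = tanh (\<beta> * x + h))"
  shows "0 < m" "m < 1" "m = tanh (\<beta> * m + h)" "\<And>x. m < x \<Longrightarrow> tanh (\<beta> * x + h) < x"
proof -
  let ?g = "\<lambda>x. tanh (\<beta> * x + h) - x"
  have g_cont: "continuous_on X ?g" for X
    by (intro continuous_intros) auto
  have g_neg: "?g x < 0" if "1 \<le> x" for x
    using that tanh_real_lt_1[of "\<beta> * x + h"] by linarith
  obtain e where e: "0 \<le> e" "e < 1" "0 < ?g e"
  proof (cases "0 < h")
    case True
    then show ?thesis by (intro that[of 0]) auto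
  next
    case False
    then have [simp]: "h = 0" "1 < \<beta>" using assms by auto
    obtain d where d: "0 < d" "\<And>y. 0 < y \<Longrightarrow> y < d \<Longrightarrow> ?g 0 < ?g (0 + y)"
      using DERIV_pos_inc_right[OF has_field_derivative_mean_field[of \<beta> h 0]] by auto
    show ?thesis using d(1) d(2)[of "min (d / 2) (1 / 2)"]
      by (intro that[of "min (d / 2) (1 / 2)"]) auto
  qed
  have ivt: "\<exists>y>x. y = tanh (\<beta> * y + h)" if pos: "0 < ?g x" for x
  proof -
    have "x < 1" using that g_neg[of x] by force
    obtain y where "x \<le> y" "y \<le> 1" "?g y = 0"
      using IVT2'[OF less_imp_le[OF g_neg[OF order_refl]] less_imp_le[OF pos] less_imp_le[OF \<open>x < 1\<close>] g_cont]
      by blast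
    then show ?thesis using that by (intro exI[of _ y]) (auto simp: order_less_le)
  qed
  let ?R = "{x. x = tanh (\<beta> * x + h)}"
  have "closed ?R"
    by (intro closed_Collect_eq continuous_intros) auto
  moreover have "?R \<subseteq> {-1..1}"
  proof
    fix x assume "x \<in> ?R"
    then show "x \<in> {-1..1}" using tanh_real_gt_neg1[of "\<beta> * x + h"] tanh_real_lt_1[of "\<beta> * x + h"] by simp
  qed
  ultimately have "compact ?R"
    by (metis bounded_closed_interval bounded_subset compact_eq_bounded_closed)
  moreover obtain y where y: "e < y" "y \<in> ?R" using ivt[OF e(3)] by auto
  ultimately obtain r where r: "r \<in> ?R" "\<And>x. x \<in> ?R \<Longrightarrow> x \<le> r"
    using compact_attains_sup[of ?R] by blast
  have m: "m = r" unfolding m_def using r by (intro Greatest_equality) auto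
  show "0 < m" using y r(2)[of y] e(1) m by auto
  show root: "m = tanh (\<beta> * m + h)" using r m by auto
  show "m < 1" using g_neg[of m] root by force
  show "tanh (\<beta> * x + h) < x" if "m < x" for x
  proof (rule ccontr)
    assume "\<not> ?thesis"
    then have "x \<in> ?R \<or> 0 < ?g x" by auto
    then show False using ivt[of x] r(2) that m by force
  qed
qed

text \<open>The slope of \<open>tanh (\<beta> x + h) - x\<close> decreases on the positive axis. If this difference, which is
  nonnegative at \<open>0\<close>, were nonpositive at \<open>x\<close>, its slope would be negative from some point before \<open>x\<close>
  on, and it could not return to \<open>0\<close> at \<open>m\<close>.\<close>

lemma mean_field_above_diagonal:
  fixes \<beta> h :: real
  assumes "0 < \<beta>" "0 \<le> h" and m: "m = tanh (\<beta> * m + h)" and x: "0 < x" "x < m"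
  shows "x < tanh (\<beta> * x + h)"
proof (rule ccontr)
  let ?g = "\<lambda>x. tanh (\<beta> * x + h) - x"
  let ?g' = "\<lambda>x. \<beta> * (1 - (tanh (\<beta> * x + h))\<^sup>2) - 1"
  assume "\<not> ?thesis"
  then have "?g x \<le> 0" by simp
  moreover have "0 \<le> ?g 0" using assms(2) by simp
  moreover obtain \<xi> where \<xi>: "0 < \<xi>" "\<xi> < x" "?g x - ?g 0 = (x - 0) * ?g' \<xi>"
    using MVT2[OF x(1), of ?g ?g'] has_field_derivative_mean_field by blast
  ultimately have "(x - 0) * ?g' \<xi> \<le> 0" by (metis diff_mono diff_zero)
  then have neg: "?g' \<xi> \<le> 0" using x(1) by (simp add: mult_le_0_iff)
  obtain \<zeta> where \<zeta>: "x < \<zeta>" "\<zeta> < m" "?g m - ?g x = (m - x) * ?g' \<zeta>"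
    using MVT2[OF x(2), of ?g ?g'] has_field_derivative_mean_field by blast
  have "0 \<le> \<beta> * \<xi> + h" "\<beta> * \<xi> + h < \<beta> * \<zeta> + h"
    using \<xi> \<zeta> assms(1,2) by auto
  then have "(tanh (\<beta> * \<xi> + h))\<^sup>2 < (tanh (\<beta> * \<zeta> + h))\<^sup>2"
    by (intro power_strict_mono) auto
  then have "?g' \<zeta> < ?g' \<xi>" using assms(1) by simp
  then have "(m - x) * ?g' \<zeta> < 0" using neg x by (intro mult_pos_neg) auto
  then show False using \<zeta>(3) \<open>?g x \<le> 0\<close> m by simp
qed

text \<open>The derivative of the free energy is \<open>\<beta> (tanh (\<beta> x + h) - x)\<close>, so it increases before the largest
  solution and decreases after it.\<close>

lemma free_energy_less_max:
  fixes \<beta> h :: real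
  assumes "0 < \<beta>" "0 \<le> h" "1 < \<beta> \<or> 0 < h"
  defines "m \<equiv> (GREATEST x. x = tanh (\<beta> * x + h))"
  assumes "0 \<le> x" "x \<noteq> m"
  shows "free_energy \<beta> h x < free_energy \<beta> h m"
proof -
  note root = greatest_mean_field_root[OF assms(1-3), folded m_def]
  have cont: "continuous_on X (free_energy \<beta> h)" for X
    unfolding free_energy_def[abs_def] by (intro continuous_intros) auto
  show ?thesis
  proof (cases "x < m")
    case True
    then show ?thesis
    proof (rule DERIV_pos_imp_increasing_open[OF _ _ cont])
      fix y assume "x < y" "y < m"
      then have "0 < \<beta> * (tanh (\<beta> * y + h) - y)"
        using mean_field_above_diagonal[OF assms(1,2) root(3), of y] assms by simp
      then show "\<exists>d. (free_energy \<beta> h has_field_derivative d) (at y) \<and> 0 < d"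
        using has_field_derivative_free_energy by blast
    qed
  next
    case False
    then have "m < x" using assms by simp
    then show ?thesis
    proof (rule DERIV_neg_imp_decreasing_open[OF _ _ cont])
      fix y assume "m < y" "y < x"
      then have "\<beta> * (tanh (\<beta> * y + h) - y) < 0"
        using root(4)[of y] assms(1) by (intro mult_pos_neg) auto
      then show "\<exists>d. (free_energy \<beta> h has_field_derivative d) (at y) \<and> d < 0"
        using has_field_derivative_free_energy by blast
    qed
  qed
qed

lemma free_energy_abs: "free_energy \<beta> 0 \<bar>x\<bar> = free_energy \<beta> 0 x"
  by (cases "0 \<le> x") (auto simp: free_energy_def)

lemma free_energy_less_abs:
  assumes "0 < \<beta>" "0 < h" "x < 0"
  shows "free_energy \<beta> h x < free_energy \<beta> h \<bar>x\<bar>"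
proof -
  have "\<beta> * x < 0" using assms by (simp add: mult_pos_neg)
  then have "\<bar>\<beta> * x + h\<bar> < \<beta> * \<bar>x\<bar> + h"
    using assms by (simp add: abs_if)
  then have "cosh \<bar>\<beta> * x + h\<bar> < cosh (\<beta> * \<bar>x\<bar> + h)"
    by (subst cosh_real_nonneg_less_iff) auto
  moreover have "cosh \<bar>\<beta> * x + h\<bar> = cosh (\<beta> * x + h)" by (rule cosh_real_abs)
  ultimately have "ln (cosh (\<beta> * x + h)) < ln (cosh (\<beta> * \<bar>x\<bar> + h))"
    by (simp only: ln_less_cancel_iff cosh_real_pos)
  then show ?thesis by (simp only: free_energy_def power2_abs diff_strict_right_mono)
qed

section \<open>Concentration of a single block\<close>

lemma curie_weiss_mono:
  assumes "finite A" "\<And>x. \<bar>x\<bar> \<le> 1 \<Longrightarrow> f x \<le> g x"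
  shows "curie_weiss \<beta> h A f \<le> curie_weiss \<beta> h A g"
  unfolding curie_weiss_def using assms by (intro wmean_mono weighted_curie_weiss) (auto simp: abs_mean_spin_le_1)

lemma curie_weiss_const [simp]: "finite A \<Longrightarrow> curie_weiss \<beta> h A (\<lambda>_. c) = c"
  by (simp add: curie_weiss_def weighted_curie_weiss)

lemma curie_weiss_cmult: "curie_weiss \<beta> h A (\<lambda>x. c * f x) = c * curie_weiss \<beta> h A f"
  by (simp add: curie_weiss_def wmean_cmult)

lemma curie_weiss_pos: "finite A \<Longrightarrow> (\<And>x. 0 < f x) \<Longrightarrow> 0 < curie_weiss \<beta> h A f"
  unfolding curie_weiss_def by (intro wmean_pos weighted_curie_weiss)

lemma curie_weiss_field:
  assumes "finite A"
  shows "curie_weiss \<beta> h A f = curie_weiss \<beta> 0 A (\<lambda>x. exp (real (card A) * (h * x)) * f x) /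
    curie_weiss \<beta> 0 A (\<lambda>x. exp (real (card A) * (h * x)))"
  unfolding curie_weiss_def
  by (subst wmean_tilt[OF weighted_curie_weiss[OF assms], symmetric])
    (simp add: curie_weiss_weight_def[abs_def] distrib_left exp_add)

lemma curie_weiss_flip:
  assumes "finite A"
  shows "curie_weiss \<beta> 0 A (\<lambda>x. f (- x)) = curie_weiss \<beta> 0 A f"
proof -
  let ?flip = "\<lambda>\<sigma>. \<lambda>i\<in>A. - \<sigma> i :: real"
  have mean: "mean_spin A (?flip \<sigma>) = - mean_spin A \<sigma>" for \<sigma>
    by (simp add: mean_spin_def sum_negf)
  have "bij_betw ?flip (signs A) (signs A)"
    by (rule bij_betwI[where g = ?flip])
      (auto simp: signs_def PiE_iff extensional_def restrict_def fun_eq_iff)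
  from wmean_bij[OF this, of "curie_weiss_weight \<beta> 0 A" "\<lambda>\<sigma>. f (mean_spin A \<sigma>)"] show ?thesis
    by (simp add: curie_weiss_def curie_weiss_weight_def[abs_def] mean)
qed

lemma curie_weiss_flip_sign: "finite A \<Longrightarrow> s \<in> {-1, 1} \<Longrightarrow> curie_weiss \<beta> 0 A (\<lambda>x. f (s * x)) = curie_weiss \<beta> 0 A f"
  using curie_weiss_flip[of A \<beta> f] by auto

lemma m_star_props:
  assumes "1 < \<beta>"
  shows "0 < m_star \<beta>" "m_star \<beta> < 1"
  using greatest_mean_field_root(1,2)[of \<beta> 0] assms by (simp_all add: m_star_def)

lemma curie_weiss_off_m_star:
  assumes "1 < \<beta>" "0 < \<epsilon>"
  obtains K \<delta> where "0 < K" "0 < \<delta>"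
    "\<And>A :: 'i set. finite A \<Longrightarrow>
       curie_weiss \<beta> 0 A (\<lambda>x. of_bool (\<epsilon> \<le> \<bar>\<bar>x\<bar> - m_star \<beta>\<bar>)) \<le> K * exp (- \<delta> * real (card A))"
proof -
  let ?F = "{-1..1} \<inter> {x. \<epsilon> \<le> \<bar>\<bar>x\<bar> - m_star \<beta>\<bar>}"
  have F: "compact ?F"
    by (intro compact_Int_closed closed_Collect_le continuous_intros) auto
  have less: "free_energy \<beta> 0 x < free_energy \<beta> 0 (m_star \<beta>)" if "x \<in> ?F" for x
    using free_energy_less_max[of \<beta> 0 "\<bar>x\<bar>"] that assms
    by (auto simp: free_energy_abs m_star_def)
  obtain K \<delta> where K: "0 < K" "0 < \<delta>"
    "\<And>A :: 'i set. finite A \<Longrightarrow> curie_weiss \<beta> 0 A (\<lambda>x. of_bool (x \<in> ?F)) \<le> K * exp (- \<delta> * real (card A))"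
    by (rule curie_weiss_exponentially_small[OF _ F less]) (use assms in auto)
  have "curie_weiss \<beta> 0 A (\<lambda>x. of_bool (\<epsilon> \<le> \<bar>\<bar>x\<bar> - m_star \<beta>\<bar>)) \<le> K * exp (- \<delta> * real (card A))"
    if "finite A" for A :: "'i set"
    using curie_weiss_mono[OF that, of "\<lambda>x. of_bool (\<epsilon> \<le> \<bar>\<bar>x\<bar> - m_star \<beta>\<bar>)" "\<lambda>x. of_bool (x \<in> ?F)" \<beta> 0] K(3)[OF that]
    by (force simp: abs_le_iff)
  then show ?thesis using K that by blast
qed

lemma curie_weiss_off_field_maximizer:
  assumes "0 < \<beta>" "0 < h" "0 < \<epsilon>"
  defines "m \<equiv> (GREATEST x. x = tanh (\<beta> * x + h))"
  obtains K \<delta> where "0 < K" "0 < \<delta>"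
    "\<And>A :: 'i set. finite A \<Longrightarrow>
       curie_weiss \<beta> h A (\<lambda>x. of_bool (\<epsilon> \<le> \<bar>x - m\<bar>)) \<le> K * exp (- \<delta> * real (card A))"
proof -
  let ?F = "{-1..1} \<inter> {x. \<epsilon> \<le> \<bar>x - m\<bar>}"
  have F: "compact ?F"
    by (intro compact_Int_closed closed_Collect_le continuous_intros) auto
  have less: "free_energy \<beta> h x < free_energy \<beta> h m" if "x \<in> ?F" for x
  proof (cases "0 \<le> x")
    case True
    then show ?thesis
      using free_energy_less_max[of \<beta> h x] that assms by auto
  next
    case False
    then have "free_energy \<beta> h x < free_energy \<beta> h \<bar>x\<bar>"
      using assms by (intro free_energy_less_abs) auto
    also have "\<dots> \<le> free_energy \<beta> h m"
      using free_energy_less_max[of \<beta> h "\<bar>x\<bar>"] assms by force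
    finally show ?thesis .
  qed
  obtain K \<delta> where K: "0 < K" "0 < \<delta>"
    "\<And>A :: 'i set. finite A \<Longrightarrow> curie_weiss \<beta> h A (\<lambda>x. of_bool (x \<in> ?F)) \<le> K * exp (- \<delta> * real (card A))"
    by (rule curie_weiss_exponentially_small[OF _ F less]) (use assms in auto)
  have "curie_weiss \<beta> h A (\<lambda>x. of_bool (\<epsilon> \<le> \<bar>x - m\<bar>)) \<le> K * exp (- \<delta> * real (card A))"
    if "finite A" for A :: "'i set"
    using curie_weiss_mono[OF that, of "\<lambda>x. of_bool (\<epsilon> \<le> \<bar>x - m\<bar>)" "\<lambda>x. of_bool (x \<in> ?F)" \<beta> h] K(3)[OF that]
    by (force simp: abs_le_iff)
  then show ?thesis using K that by blast
qed

text \<open>A field error of \<open>\<theta>\<close> changes each weight by at most \<open>exp (n \<theta>)\<close>, once in the numerator and once in the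
  normalization. Hence concentration at rate \<open>\<delta>\<close> in the field \<open>h0\<close> holds uniformly for all fields
  within a distance below \<open>\<delta> / 2\<close>, which is needed because the field acting on the middle block is random.\<close>

lemma curie_weiss_perturbed_field:
  assumes A: "finite A" and h: "\<bar>h - h0\<bar> \<le> \<theta>" and f: "\<And>x. 0 \<le> f x"
    and conc: "curie_weiss \<beta> h0 A f \<le> K" and K: "0 \<le> K"
  shows "curie_weiss \<beta> 0 A (\<lambda>x. exp (real (card A) * (h * x)) * f x) \<le>
    K * exp (2 * \<theta> * real (card A)) * curie_weiss \<beta> 0 A (\<lambda>x. exp (real (card A) * (h * x)))"
proof -
  let ?n = "real (card A)"
  have compare: "?n * (h * x) \<le> ?n * \<theta> + ?n * (h' * x)" if "\<bar>x\<bar> \<le> 1" "\<bar>h - h'\<bar> \<le> \<theta>" for x h h'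
  proof -
    have "\<bar>(h - h') * x\<bar> \<le> \<theta> * 1"
      unfolding abs_mult using that by (intro mult_mono) auto
    then have "h * x \<le> \<theta> + h' * x" by (simp add: left_diff_distrib abs_le_iff)
    from mult_left_mono[OF this, of ?n] show ?thesis by (simp add: distrib_left)
  qed
  have pos: "0 < curie_weiss \<beta> 0 A (\<lambda>x. exp (?n * (h' * x)))" for h'
    using A by (intro curie_weiss_pos) auto
  have "curie_weiss \<beta> 0 A (\<lambda>x. exp (?n * (h * x)) * f x) \<le> curie_weiss \<beta> 0 A (\<lambda>x. exp (?n * \<theta>) * (exp (?n * (h0 * x)) * f x))"
    using compare[of _ h h0] h f
    by (intro curie_weiss_mono A) (simp add: mult_right_mono flip: mult.assoc exp_add)
  also have "\<dots> = exp (?n * \<theta>) * (curie_weiss \<beta> h0 A f * curie_weiss \<beta> 0 A (\<lambda>x. exp (?n * (h0 * x))))"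
    using pos[of h0] by (simp add: curie_weiss_cmult curie_weiss_field[OF A, of \<beta> h0 f])
  also have "\<dots> \<le> exp (?n * \<theta>) * (K * (exp (?n * \<theta>) * curie_weiss \<beta> 0 A (\<lambda>x. exp (?n * (h * x)))))"
  proof (intro mult_left_mono mult_mono conc K)
    have "curie_weiss \<beta> 0 A (\<lambda>x. exp (?n * (h0 * x))) \<le> curie_weiss \<beta> 0 A (\<lambda>x. exp (?n * \<theta>) * exp (?n * (h * x)))"
      using compare[of _ h0 h] h by (intro curie_weiss_mono A) (simp add: abs_minus_commute flip: exp_add)
    then show "curie_weiss \<beta> 0 A (\<lambda>x. exp (?n * (h0 * x))) \<le> exp (?n * \<theta>) * curie_weiss \<beta> 0 A (\<lambda>x. exp (?n * (h * x)))"
      by (simp add: curie_weiss_cmult)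
  qed (use pos[of h0] in auto)
  also have "\<dots> = K * exp (2 * \<theta> * ?n) * curie_weiss \<beta> 0 A (\<lambda>x. exp (?n * (h * x)))"
    by (simp add: mult_exp_exp algebra_simps)
  finally show ?thesis .
qed

section \<open>Three coupled blocks\<close>

text \<open>Expectation of a function of the three magnetizations when the blocks are independent and have no
  field. The middle block is integrated first, so that estimates given the outer magnetizations
  can be made inside the two outer integrals.\<close>

definition indep_mean :: "real \<Rightarrow> 'i set \<Rightarrow> 'i set \<Rightarrow> 'i set \<Rightarrow> (real \<times> real \<times> real \<Rightarrow> real) \<Rightarrow> real" where
  "indep_mean \<beta> A1 A2 A3 F = curie_weiss \<beta> 0 A1 (\<lambda>x. curie_weiss \<beta> 0 A3 (\<lambda>z. curie_weiss \<beta> 0 A2 (\<lambda>y. F (x, y, z))))"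

text \<open>The middle block comes last, in the order of integration of \<open>indep_mean\<close>; \<open>mags\<close> restores the order
  of the magnetization vector.\<close>

definition configs :: "'i set \<Rightarrow> 'i set \<Rightarrow> 'i set \<Rightarrow> (('i \<Rightarrow> real) \<times> ('i \<Rightarrow> real) \<times> ('i \<Rightarrow> real)) set" where
  "configs A1 A2 A3 = signs A1 \<times> signs A3 \<times> signs A2"

definition mags :: "'i set \<Rightarrow> 'i set \<Rightarrow> 'i set \<Rightarrow> ('i \<Rightarrow> real) \<times> ('i \<Rightarrow> real) \<times> ('i \<Rightarrow> real) \<Rightarrow> real \<times> real \<times> real" where
  "mags A1 A2 A3 = (\<lambda>(\<sigma>1, \<sigma>3, \<sigma>2). (mean_spin A1 \<sigma>1, mean_spin A2 \<sigma>2, mean_spin A3 \<sigma>3))"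

definition indep_weight :: "real \<Rightarrow> 'i set \<Rightarrow> 'i set \<Rightarrow> 'i set \<Rightarrow> ('i \<Rightarrow> real) \<times> ('i \<Rightarrow> real) \<times> ('i \<Rightarrow> real) \<Rightarrow> real" where
  "indep_weight \<beta> A1 A2 A3 = (\<lambda>(\<sigma>1, \<sigma>3, \<sigma>2). curie_weiss_weight \<beta> 0 A1 \<sigma>1 * (curie_weiss_weight \<beta> 0 A3 \<sigma>3 * curie_weiss_weight \<beta> 0 A2 \<sigma>2))"

lemma indep_mean_eq_wmean:
  "indep_mean \<beta> A1 A2 A3 F =
    wmean (configs A1 A2 A3) (indep_weight \<beta> A1 A2 A3) (\<lambda>s. F (mags A1 A2 A3 s))"
proof -
  have w: "indep_weight \<beta> A1 A2 A3 = (\<lambda>(s, t). curie_weiss_weight \<beta> 0 A1 s * (\<lambda>(s, t). curie_weiss_weight \<beta> 0 A3 s * curie_weiss_weight \<beta> 0 A2 t) t)"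
    by (auto simp: indep_weight_def)
  show ?thesis
    unfolding w configs_def wmean_times by (simp add: indep_mean_def curie_weiss_def mags_def)
qed

lemma weighted_configs:
  assumes "finite A1" "finite A2" "finite A3"
  shows "weighted (configs A1 A2 A3) (indep_weight \<beta> A1 A2 A3)"
  using assms by (auto simp: weighted_def configs_def indep_weight_def finite_signs signs_nonempty curie_weiss_weight_def)

lemma indep_mean_mono:
  assumes "finite A1" "finite A2" "finite A3"
    "\<And>x y z. \<bar>x\<bar> \<le> 1 \<Longrightarrow> \<bar>y\<bar> \<le> 1 \<Longrightarrow> \<bar>z\<bar> \<le> 1 \<Longrightarrow> F (x, y, z) \<le> G (x, y, z)"
  shows "indep_mean \<beta> A1 A2 A3 F \<le> indep_mean \<beta> A1 A2 A3 G"
  unfolding indep_mean_def using assms by (intro curie_weiss_mono) auto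

lemma indep_mean_const [simp]:
  "finite A1 \<Longrightarrow> finite A2 \<Longrightarrow> finite A3 \<Longrightarrow> indep_mean \<beta> A1 A2 A3 (\<lambda>_. c) = c"
  by (simp add: indep_mean_def)

lemma indep_mean_add:
  "indep_mean \<beta> A1 A2 A3 (\<lambda>v. F v + G v) = indep_mean \<beta> A1 A2 A3 F + indep_mean \<beta> A1 A2 A3 G"
  unfolding indep_mean_eq_wmean by (rule wmean_add)

lemma indep_mean_diff:
  "indep_mean \<beta> A1 A2 A3 (\<lambda>v. F v - G v) = indep_mean \<beta> A1 A2 A3 F - indep_mean \<beta> A1 A2 A3 G"
  unfolding indep_mean_eq_wmean by (rule wmean_diff)

lemma indep_mean_cmult:
  "indep_mean \<beta> A1 A2 A3 (\<lambda>v. c * F v) = c * indep_mean \<beta> A1 A2 A3 F"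
  unfolding indep_mean_eq_wmean by (rule wmean_cmult)

lemma indep_mean_sum:
  "indep_mean \<beta> A1 A2 A3 (\<lambda>v. \<Sum>i\<in>I. F i v) = (\<Sum>i\<in>I. indep_mean \<beta> A1 A2 A3 (F i))"
  by (induction I rule: infinite_finite_induct)
    (simp_all add: indep_mean_add, simp_all add: indep_mean_eq_wmean wmean_def)

lemma indep_mean_flip:
  assumes "finite A1" "finite A2" "finite A3" "s1 \<in> {-1, 1}" "s2 \<in> {-1, 1}" "s3 \<in> {-1, 1}"
  shows "indep_mean \<beta> A1 A2 A3 (\<lambda>(x, y, z). F (s1 * x, s2 * y, s3 * z)) = indep_mean \<beta> A1 A2 A3 F"
  using curie_weiss_flip_sign[OF assms(2,5), of \<beta> "\<lambda>y. F (_, y, _)"]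
    curie_weiss_flip_sign[OF assms(3,6), of \<beta> "\<lambda>z. curie_weiss \<beta> 0 A2 (\<lambda>y. F (_, y, z))"]
    curie_weiss_flip_sign[OF assms(1,4), of \<beta> "\<lambda>x. curie_weiss \<beta> 0 A3 (\<lambda>z. curie_weiss \<beta> 0 A2 (\<lambda>y. F (x, y, z)))"]
  by (simp add: indep_mean_def)

text \<open>The eight ways of flipping some of the blocks all preserve the independent model.\<close>

definition sign_average :: "(real \<times> real \<times> real \<Rightarrow> real) \<Rightarrow> real \<times> real \<times> real \<Rightarrow> real" where
  "sign_average F = (\<lambda>(x, y, z).
     (\<Sum>(s1, s2, s3)\<in>{-1, 1} \<times> {-1, 1} \<times> {-1, 1}. F (s1 * x, s2 * y, s3 * z)) / 8)"

lemma indep_mean_sign_average: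
  assumes "finite A1" "finite A2" "finite A3"
  shows "indep_mean \<beta> A1 A2 A3 (sign_average F) = indep_mean \<beta> A1 A2 A3 F"
proof -
  let ?C = "{-1, 1 :: real} \<times> {-1, 1 :: real} \<times> {-1, 1 :: real}"
  let ?f = "\<lambda>s. \<lambda>(x, y, z). F (fst s * x, fst (snd s) * y, snd (snd s) * z)"
  have eq: "sign_average F = (\<lambda>v. 1 / 8 * (\<Sum>s\<in>?C. ?f s v))"
    by (simp only: sign_average_def fun_eq_iff split_beta times_divide_eq_left mult_1) simp
  have "indep_mean \<beta> A1 A2 A3 (sign_average F) = 1 / 8 * (\<Sum>s\<in>?C. indep_mean \<beta> A1 A2 A3 (?f s))"
    unfolding eq indep_mean_cmult indep_mean_sum ..
  also have "(\<Sum>s\<in>?C. indep_mean \<beta> A1 A2 A3 (?f s)) = (\<Sum>s\<in>?C. indep_mean \<beta> A1 A2 A3 F)"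
  proof (rule sum.cong[OF refl])
    fix s assume "s \<in> ?C"
    then show "indep_mean \<beta> A1 A2 A3 (?f s) = indep_mean \<beta> A1 A2 A3 F"
      using indep_mean_flip[OF assms, of "fst s" "fst (snd s)" "snd (snd s)" \<beta> F] by auto
  qed
  also have "1 / 8 * \<dots> = indep_mean \<beta> A1 A2 A3 F"
    by (subst sum_constant, subst card_cartesian_product, subst card_cartesian_product) simp
  finally show ?thesis .
qed

text \<open>The averaged function depends only on the absolute values of the magnetizations, which are the quantities
  that concentrate.\<close>

lemma sign_average_abs:
  "sign_average F (\<bar>x\<bar>, \<bar>y\<bar>, \<bar>z\<bar>) = sign_average F (x, y, z)"
  by (cases "0 \<le> x"; cases "0 \<le> y"; cases "0 \<le> z") (simp_all add: sign_average_def flip: sum.cartesian_product)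

definition coupling :: "real \<Rightarrow> real \<times> real \<times> real \<Rightarrow> real" where
  "coupling a = (\<lambda>(x, y, z). exp (a * (y * (x + z))))"

text \<open>Expectation in the coupled model, written as a change of measure from the independent one.\<close>

definition block_gibbs :: "real \<Rightarrow> real \<Rightarrow> 'i set \<Rightarrow> 'i set \<Rightarrow> 'i set \<Rightarrow> (real \<times> real \<times> real \<Rightarrow> real) \<Rightarrow> real" where
  "block_gibbs \<beta> a A1 A2 A3 F =
     indep_mean \<beta> A1 A2 A3 (\<lambda>v. coupling a v * F v) / indep_mean \<beta> A1 A2 A3 (coupling a)"

lemma coupling_pos [simp]: "0 < coupling a v"
  by (simp add: coupling_def split_beta)

lemma block_gibbs_eq_wmean:
  assumes "finite A1" "finite A2" "finite A3"
  shows "block_gibbs \<beta> a A1 A2 A3 F = wmean (configs A1 A2 A3)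
    (\<lambda>s. indep_weight \<beta> A1 A2 A3 s * coupling a (mags A1 A2 A3 s)) (\<lambda>s. F (mags A1 A2 A3 s))"
  unfolding block_gibbs_def wmean_tilt[OF weighted_configs[OF assms]] indep_mean_eq_wmean ..

lemma weighted_block_gibbs:
  assumes "finite A1" "finite A2" "finite A3"
  shows "weighted (configs A1 A2 A3) (\<lambda>s. indep_weight \<beta> A1 A2 A3 s * coupling a (mags A1 A2 A3 s))"
  using weighted_configs[OF assms, of \<beta>] by (auto simp: weighted_def)

lemma indep_mean_coupling_pos:
  "finite A1 \<Longrightarrow> finite A2 \<Longrightarrow> finite A3 \<Longrightarrow> 0 < indep_mean \<beta> A1 A2 A3 (coupling a)"
  unfolding indep_mean_def by (intro curie_weiss_pos) auto

lemma mags_in_cube: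
  assumes "s \<in> configs A1 A2 A3"
  shows "mags A1 A2 A3 s \<in> {-1..1} \<times> {-1..1} \<times> {-1..1}"
  using assms by (auto simp: configs_def mags_def abs_mean_spin_le_1[unfolded abs_le_iff] minus_le_iff dest!: abs_mean_spin_le_1)

lemma block_gibbs_concentrated:
  assumes fin: "\<forall>\<^sub>F n in F. finite (A1 n) \<and> finite (A2 n) \<and> finite (A3 n)"
    and P: "finite P"
    and conc: "\<And>d. d > 0 \<Longrightarrow>
      ((\<lambda>n. block_gibbs \<beta> (a n) (A1 n) (A2 n) (A3 n) (\<lambda>v. of_bool (\<forall>p\<in>P. d \<le> dist v p))) \<longlongrightarrow> 0) F"
    and G: "continuous_on UNIV G" "\<And>p. p \<in> P \<Longrightarrow> G p = (g::real)"
  shows "((\<lambda>n. block_gibbs \<beta> (a n) (A1 n) (A2 n) (A3 n) G) \<longlongrightarrow> g) F"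
proof -
  let ?Q = "{-1..1} \<times> {-1..1} \<times> {-1..1 :: real}"
  let ?S = "\<lambda>n. configs (A1 n) (A2 n) (A3 n)" and ?X = "\<lambda>n. mags (A1 n) (A2 n) (A3 n)"
  let ?w = "\<lambda>n s. indep_weight \<beta> (A1 n) (A2 n) (A3 n) s * coupling (a n) (?X n s)"
  have "compact (G ` ?Q)"
    by (intro compact_continuous_image continuous_on_subset[OF G(1)] compact_Times) auto
  then obtain K where K: "\<And>v. v \<in> ?Q \<Longrightarrow> \<bar>G v\<bar> \<le> K"
    using compact_imp_bounded[THEN bounded_iff[THEN iffD1]] by (metis image_eqI real_norm_def)
  have "((\<lambda>n. wmean (?S n) (?w n) (\<lambda>s. G (?X n s))) \<longlongrightarrow> g) F"
  proof (rule wmean_concentrated[OF _ P])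
    show "\<forall>\<^sub>F n in F. weighted (?S n) (?w n)"
      using fin by eventually_elim (auto intro: weighted_block_gibbs)
    fix d :: real assume "d > 0"
    show "((\<lambda>n. wmean (?S n) (?w n) (\<lambda>s. of_bool (\<forall>p\<in>P. d \<le> dist (?X n s) p))) \<longlongrightarrow> 0) F"
    proof (rule Lim_transform_eventually[OF conc[OF \<open>d > 0\<close>]])
      show "\<forall>\<^sub>F n in F. block_gibbs \<beta> (a n) (A1 n) (A2 n) (A3 n) (\<lambda>v. of_bool (\<forall>p\<in>P. d \<le> dist v p)) =
          wmean (?S n) (?w n) (\<lambda>s. of_bool (\<forall>p\<in>P. d \<le> dist (?X n s) p))"
        using fin by eventually_elim (simp add: block_gibbs_eq_wmean)
    qed
  next
    show "\<bar>G (?X n s)\<bar> \<le> K" if "s \<in> ?S n" for n s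
      using K[OF mags_in_cube[OF that]] .
  qed (use G in \<open>auto simp: continuous_on_eq_continuous_at\<close>)
  then show ?thesis
    by (rule Lim_transform_eventually) (use fin in \<open>eventually_elim, simp add: block_gibbs_eq_wmean\<close>)
qed

section \<open>Bounded coupling\<close>

lemma dist_triple_le:
  fixes x y z :: real
  shows "dist (x, y, z) (x', y', z') \<le> \<bar>x - x'\<bar> + \<bar>y - y'\<bar> + \<bar>z - z'\<bar>"
proof -
  have pair: "dist (u, v) (u', v') \<le> dist u u' + dist v v'"
    for u u' :: real and v v' :: "'c::metric_space"
    unfolding dist_Pair_Pair by (rule sqrt_sum_squares_le_sum) auto
  show ?thesis
    using pair[of x "(y, z)" x' "(y', z')"] pair[of y z y' z'] by (simp add: dist_real_def)
qed

lemma indep_mean_coordinates: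
  assumes "finite A1" "finite A2" "finite A3"
  shows "indep_mean \<beta> A1 A2 A3 (\<lambda>(x, y, z). f x) = curie_weiss \<beta> 0 A1 f"
    and "indep_mean \<beta> A1 A2 A3 (\<lambda>(x, y, z). f y) = curie_weiss \<beta> 0 A2 f"
    and "indep_mean \<beta> A1 A2 A3 (\<lambda>(x, y, z). f z) = curie_weiss \<beta> 0 A3 f"
  using assms by (simp_all add: indep_mean_def)

lemma block_gibbs_0:
  assumes "finite A1" "finite A2" "finite A3"
  shows "block_gibbs \<beta> 0 A1 A2 A3 = indep_mean \<beta> A1 A2 A3"
proof -
  have "coupling 0 = (\<lambda>_. 1)" by (auto simp: coupling_def)
  then show ?thesis using assms by (auto simp: block_gibbs_def)
qed

lemma exp_decay_tendsto_0:
  assumes "0 < \<delta>" "filterlim X at_top F"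
  shows "((\<lambda>n. K * exp (- \<delta> * X n)) \<longlongrightarrow> (0::real)) F"
proof -
  have "filterlim (\<lambda>n. \<delta> * X n) at_top F"
    using assms by (intro filterlim_tendsto_pos_mult_at_top[OF tendsto_const])
  then have "filterlim (\<lambda>n. - \<delta> * X n) at_bot F"
    by (simp add: filterlim_uminus_at_bot)
  then have "((\<lambda>n. exp (- \<delta> * X n)) \<longlongrightarrow> 0) F"
    by (rule filterlim_compose[OF exp_at_bot])
  then show ?thesis by (rule tendsto_mult_right_zero)
qed

lemma curie_weiss_off_m_star_tendsto_0:
  assumes "1 < \<beta>" "0 < \<epsilon>" "\<forall>\<^sub>F n in F. finite (A n)"
    "filterlim (\<lambda>n. real (card (A n))) at_top F"
  shows "((\<lambda>n. curie_weiss \<beta> 0 (A n) (\<lambda>x. of_bool (\<epsilon> \<le> \<bar>\<bar>x\<bar> - m_star \<beta>\<bar>))) \<longlongrightarrow> 0) F"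
proof -
  obtain K \<delta> where K: "0 < K" "0 < \<delta>" and bound: "\<And>A :: 'b set. finite A \<Longrightarrow>
       curie_weiss \<beta> 0 A (\<lambda>x. of_bool (\<epsilon> \<le> \<bar>\<bar>x\<bar> - m_star \<beta>\<bar>)) \<le> K * exp (- \<delta> * real (card A))"
    using curie_weiss_off_m_star[OF assms(1,2)] by blast
  show ?thesis
  proof (rule tendsto_sandwich[OF _ _ tendsto_const exp_decay_tendsto_0[OF K(2) assms(4)]])
    show "\<forall>\<^sub>F n in F. 0 \<le> curie_weiss \<beta> 0 (A n) (\<lambda>x. of_bool (\<epsilon> \<le> \<bar>\<bar>x\<bar> - m_star \<beta>\<bar>))"
      using assms(3)
    proof eventually_elim
      case (elim n)
      then show ?case
        using curie_weiss_mono[OF elim, of "\<lambda>_. 0" "\<lambda>x. of_bool (\<epsilon> \<le> \<bar>\<bar>x\<bar> - m_star \<beta>\<bar>)" \<beta> 0] by simp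
    qed
    show "\<forall>\<^sub>F n in F. curie_weiss \<beta> 0 (A n) (\<lambda>x. of_bool (\<epsilon> \<le> \<bar>\<bar>x\<bar> - m_star \<beta>\<bar>)) \<le> K * exp (- \<delta> * real (card (A n)))"
      using assms(3) by eventually_elim (rule bound)
  qed
qed

definition off_m_star :: "real \<Rightarrow> real \<Rightarrow> real \<Rightarrow> real" where
  "off_m_star \<beta> \<epsilon> x = of_bool (\<epsilon> \<le> \<bar>\<bar>x\<bar> - m_star \<beta>\<bar>)"

definition sign_points :: "real \<Rightarrow> (real \<times> real \<times> real) set" where
  "sign_points m = (\<lambda>(s1, s2, s3). (s1 * m, s2 * m, s3 * m)) ` ({-1, 1} \<times> {-1, 1} \<times> {-1, 1})"

lemma indep_mean_off_sign_points:
  assumes "finite A1" "finite A2" "finite A3"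
  shows "indep_mean \<beta> A1 A2 A3 (\<lambda>v. of_bool (\<forall>p\<in>sign_points (m_star \<beta>). d \<le> dist v p)) \<le>
    curie_weiss \<beta> 0 A1 (off_m_star \<beta> (d / 3)) + curie_weiss \<beta> 0 A2 (off_m_star \<beta> (d / 3)) + curie_weiss \<beta> 0 A3 (off_m_star \<beta> (d / 3))"
proof -
  let ?m = "m_star \<beta>" and ?s = "\<lambda>x::real. if 0 \<le> x then 1 else (-1::real)"
  have "indep_mean \<beta> A1 A2 A3 (\<lambda>v. of_bool (\<forall>p\<in>sign_points ?m. d \<le> dist v p)) \<le>
    indep_mean \<beta> A1 A2 A3 (\<lambda>v. (\<lambda>(x, y, z). off_m_star \<beta> (d / 3) x) v + (\<lambda>(x, y, z). off_m_star \<beta> (d / 3) y) v + (\<lambda>(x, y, z). off_m_star \<beta> (d / 3) z) v)"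
  proof (intro indep_mean_mono assms)
    fix x y z :: real
    have s: "\<bar>u - ?s u * ?m\<bar> = \<bar>\<bar>u\<bar> - ?m\<bar>" for u by auto
    have "\<exists>p\<in>sign_points ?m. dist (x, y, z) p < d"
      if "\<bar>\<bar>x\<bar> - ?m\<bar> < d / 3" "\<bar>\<bar>y\<bar> - ?m\<bar> < d / 3" "\<bar>\<bar>z\<bar> - ?m\<bar> < d / 3"
    proof
      show "(?s x * ?m, ?s y * ?m, ?s z * ?m) \<in> sign_points ?m"
        unfolding sign_points_def by (rule image_eqI[where x = "(?s x, ?s y, ?s z)"]) auto
      show "dist (x, y, z) (?s x * ?m, ?s y * ?m, ?s z * ?m) < d"
        using dist_triple_le[of x y z "?s x * ?m" "?s y * ?m" "?s z * ?m"] that unfolding s by linarith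
    qed
    then show "of_bool (\<forall>p\<in>sign_points ?m. d \<le> dist (x, y, z) p) \<le> (\<lambda>(x, y, z). off_m_star \<beta> (d / 3) x) (x, y, z) +
        (\<lambda>(x, y, z). off_m_star \<beta> (d / 3) y) (x, y, z) + (\<lambda>(x, y, z). off_m_star \<beta> (d / 3) z) (x, y, z)"
      by (auto simp: off_m_star_def not_le)
  qed
  then show ?thesis by (simp only: indep_mean_add indep_mean_coordinates[OF assms])
qed

lemma continuous_on_sign_average:
  assumes "continuous_on UNIV G"
  shows "continuous_on UNIV (sign_average G)"
proof -
  have "continuous_on UNIV (\<lambda>v. G (s1 * fst v, s2 * fst (snd v), s3 * snd (snd v)))" for s1 s2 s3
    by (intro continuous_on_compose2[OF assms] continuous_intros) auto
  then show ?thesis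
    unfolding sign_average_def split_beta by (intro continuous_intros) auto
qed

text \<open>After averaging over the flips, the test function takes a single value on the eight limit points.\<close>

lemma indep_mean_tendsto:
  assumes beta: "1 < \<beta>"
    and fin: "\<forall>\<^sub>F n in F. finite (A1 n) \<and> finite (A2 n) \<and> finite (A3 n)"
    and card: "filterlim (\<lambda>n. real (card (A1 n))) at_top F" "filterlim (\<lambda>n. real (card (A2 n))) at_top F"
      "filterlim (\<lambda>n. real (card (A3 n))) at_top F"
    and G: "continuous_on UNIV G"
  shows "((\<lambda>n. indep_mean \<beta> (A1 n) (A2 n) (A3 n) G) \<longlongrightarrow> sign_average G (m_star \<beta>, m_star \<beta>, m_star \<beta>)) F"
proof -
  let ?m = "m_star \<beta>"
  have "((\<lambda>n. block_gibbs \<beta> 0 (A1 n) (A2 n) (A3 n) (sign_average G)) \<longlongrightarrow> sign_average G (?m, ?m, ?m)) F"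
  proof (rule block_gibbs_concentrated[OF fin, where P = "sign_points ?m"])
    show "finite (sign_points ?m)" by (simp add: sign_points_def)
    show "continuous_on UNIV (sign_average G)" by (rule continuous_on_sign_average[OF G])
    fix p assume "p \<in> sign_points ?m"
    then obtain s where s: "s \<in> {-1, 1} \<times> {-1, 1} \<times> {-1, 1}" "p = (fst s * ?m, fst (snd s) * ?m, snd (snd s) * ?m)"
      unfolding sign_points_def by (rule imageE) (simp add: split_beta)
    then have "\<bar>fst s\<bar> = 1" "\<bar>fst (snd s)\<bar> = 1" "\<bar>snd (snd s)\<bar> = 1" by auto
    then    show "sign_average G p = sign_average G (?m, ?m, ?m)"
      using sign_average_abs[of G "fst s * ?m" "fst (snd s) * ?m" "snd (snd s) * ?m"] m_star_props(1)[OF beta] s(2)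
      by (simp add: abs_mult)
  next
    fix d :: real assume "d > 0"
    have off_m_star: "((\<lambda>n. curie_weiss \<beta> 0 (A n) (off_m_star \<beta> (d / 3))) \<longlongrightarrow> 0) F"
      if "\<forall>\<^sub>F n in F. finite (A n)" "filterlim (\<lambda>n. real (card (A n))) at_top F" for A :: "'a \<Rightarrow> 'b set"
      unfolding off_m_star_def[abs_def] using that \<open>d > 0\<close> by (intro curie_weiss_off_m_star_tendsto_0 beta) auto
    show "((\<lambda>n. block_gibbs \<beta> 0 (A1 n) (A2 n) (A3 n)
        (\<lambda>v. of_bool (\<forall>p\<in>sign_points ?m. d \<le> dist v p))) \<longlongrightarrow> 0) F"
    proof (rule tendsto_sandwich[OF _ _ tendsto_const])
      show "((\<lambda>n. curie_weiss \<beta> 0 (A1 n) (off_m_star \<beta> (d / 3)) + curie_weiss \<beta> 0 (A2 n) (off_m_star \<beta> (d / 3)) + curie_weiss \<beta> 0 (A3 n) (off_m_star \<beta> (d / 3))) \<longlongrightarrow> 0) F"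
        by (intro tendsto_add_zero off_m_star card eventually_mono[OF fin]) auto
      show "\<forall>\<^sub>F n in F. 0 \<le> block_gibbs \<beta> 0 (A1 n) (A2 n) (A3 n) (\<lambda>v. of_bool (\<forall>p\<in>sign_points ?m. d \<le> dist v p))"
        using fin
      proof eventually_elim
        case (elim n)
        have "indep_mean \<beta> (A1 n) (A2 n) (A3 n) (\<lambda>_. 0) \<le>
            indep_mean \<beta> (A1 n) (A2 n) (A3 n) (\<lambda>v. of_bool (\<forall>p\<in>sign_points ?m. d \<le> dist v p))"
          using elim by (intro indep_mean_mono) auto
        then show ?case using elim by (simp add: block_gibbs_0)
      qed
      show "\<forall>\<^sub>F n in F. block_gibbs \<beta> 0 (A1 n) (A2 n) (A3 n) (\<lambda>v. of_bool (\<forall>p\<in>sign_points ?m. d \<le> dist v p)) \<le>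
         curie_weiss \<beta> 0 (A1 n) (off_m_star \<beta> (d / 3)) + curie_weiss \<beta> 0 (A2 n) (off_m_star \<beta> (d / 3)) + curie_weiss \<beta> 0 (A3 n) (off_m_star \<beta> (d / 3))"
        using fin by eventually_elim (simp add: block_gibbs_0 indep_mean_off_sign_points)
    qed
  qed
  then show ?thesis
    by (rule Lim_transform_eventually) (use fin in \<open>eventually_elim, simp add: block_gibbs_0 indep_mean_sign_average\<close>)
qed

lemma abs_exp_minus_1_le: "\<bar>exp u - 1\<bar> \<le> exp \<bar>u\<bar> - (1::real)"
proof (cases "0 \<le> u")
  case False
  have "exp u + exp (- u) \<ge> 2"
    using cosh_real_ge_1[of u] by (simp add: cosh_def)
  then show ?thesis using False by (simp add: abs_if)
qed simp

text \<open>On the cube \<open>[-1, 1]\<^sup>3\<close>, which carries all magnetization vectors, the couplings with parameters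
  \<open>a n\<close> and \<open>a0\<close> differ by a factor between \<open>exp (- 2 |a n - a0|)\<close> and \<open>exp (2 |a n - a0|)\<close>.\<close>

lemma indep_mean_coupling_tendsto:
  assumes beta: "1 < \<beta>"
    and fin: "\<forall>\<^sub>F n in F. finite (A1 n) \<and> finite (A2 n) \<and> finite (A3 n)"
    and card: "filterlim (\<lambda>n. real (card (A1 n))) at_top F" "filterlim (\<lambda>n. real (card (A2 n))) at_top F"
      "filterlim (\<lambda>n. real (card (A3 n))) at_top F"
    and a: "(a \<longlongrightarrow> a0) F"
    and G: "continuous_on UNIV G"
  shows "((\<lambda>n. indep_mean \<beta> (A1 n) (A2 n) (A3 n) (\<lambda>v. coupling (a n) v * G v)) \<longlongrightarrow>
    sign_average (\<lambda>v. coupling a0 v * G v) (m_star \<beta>, m_star \<beta>, m_star \<beta>)) F"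
proof -
  let ?E = "\<lambda>n. indep_mean \<beta> (A1 n) (A2 n) (A3 n)"
  let ?G0 = "\<lambda>v. coupling a0 v * G v"
  let ?Q = "{-1..1} \<times> {-1..1} \<times> {-1..1 :: real}"
  have G0: "continuous_on UNIV ?G0"
    unfolding coupling_def split_beta by (intro continuous_intros G)
  have "compact (?G0 ` ?Q)"
    by (intro compact_continuous_image continuous_on_subset[OF G0] compact_Times) auto
  then obtain K where K: "\<And>v. v \<in> ?Q \<Longrightarrow> \<bar>?G0 v\<bar> \<le> K"
    using compact_imp_bounded[THEN bounded_iff[THEN iffD1]] by (metis (no_types, lifting) image_eqI real_norm_def)
  have pt: "\<bar>coupling (a n) (x, y, z) * G (x, y, z) - ?G0 (x, y, z)\<bar> \<le> K * (exp (2 * \<bar>a n - a0\<bar>) - 1)"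
    if "\<bar>x\<bar> \<le> 1" "\<bar>y\<bar> \<le> 1" "\<bar>z\<bar> \<le> 1" for n x y z
  proof -
    let ?u = "(a n - a0) * (y * (x + z))"
    have "\<bar>?u\<bar> \<le> \<bar>a n - a0\<bar> * (1 * 2)"
      unfolding abs_mult using that by (intro mult_left_mono mult_mono) auto
    then have exp_u: "\<bar>exp ?u - 1\<bar> \<le> exp (2 * \<bar>a n - a0\<bar>) - 1"
      using order_trans[OF abs_exp_minus_1_le[of ?u], of "exp (2 * \<bar>a n - a0\<bar>) - 1"] by simp
    have "coupling (a n) (x, y, z) = coupling a0 (x, y, z) * exp ?u"
      by (simp add: coupling_def algebra_simps flip: exp_add)
    then have "\<bar>coupling (a n) (x, y, z) * G (x, y, z) - ?G0 (x, y, z)\<bar> = \<bar>?G0 (x, y, z)\<bar> * \<bar>exp ?u - 1\<bar>"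
      by (simp add: algebra_simps flip: abs_mult)
    also have "\<dots> \<le> K * (exp (2 * \<bar>a n - a0\<bar>) - 1)"
    proof (rule mult_mono[OF _ exp_u])
      show "\<bar>?G0 (x, y, z)\<bar> \<le> K" using that by (intro K) (auto simp: abs_le_iff)
      then show "0 \<le> K" by linarith
    qed simp
    finally show ?thesis .
  qed
  have "((\<lambda>n. ?E n (\<lambda>v. coupling (a n) v * G v) - ?E n ?G0) \<longlongrightarrow> 0) F"
  proof (rule Lim_null_comparison)
    show "\<forall>\<^sub>F n in F. norm (?E n (\<lambda>v. coupling (a n) v * G v) - ?E n ?G0) \<le> K * (exp (2 * \<bar>a n - a0\<bar>) - 1)"
      using fin
    proof eventually_elim
      case (elim n)
      let ?D = "\<lambda>v. coupling (a n) v * G v - ?G0 v"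
      have "?E n ?D \<le> ?E n (\<lambda>_. K * (exp (2 * \<bar>a n - a0\<bar>) - 1))"
        using elim pt[of _ _ _ n] by (intro indep_mean_mono) (auto simp: abs_le_iff)
      moreover have "?E n (\<lambda>_. - (K * (exp (2 * \<bar>a n - a0\<bar>) - 1))) \<le> ?E n ?D"
        using elim pt[of _ _ _ n] by (intro indep_mean_mono) (auto simp only: abs_le_iff minus_le_iff)
      ultimately show ?case using elim by (simp add: indep_mean_diff abs_le_iff minus_le_iff)
    qed
    have "((\<lambda>n. K * (exp (2 * \<bar>a n - a0\<bar>) - 1)) \<longlongrightarrow> K * (exp (2 * \<bar>a0 - a0\<bar>) - 1)) F"
      by (intro tendsto_intros a)
    then show "((\<lambda>n. K * (exp (2 * \<bar>a n - a0\<bar>) - 1)) \<longlongrightarrow> 0) F" by simp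
  qed
  from tendsto_add[OF this indep_mean_tendsto[OF beta fin card G0]] show ?thesis by simp
qed

lemma block_gibbs_tendsto_bounded_coupling:
  assumes beta: "1 < \<beta>"
    and fin: "\<forall>\<^sub>F n in F. finite (A1 n) \<and> finite (A2 n) \<and> finite (A3 n)"
    and card: "filterlim (\<lambda>n. real (card (A1 n))) at_top F" "filterlim (\<lambda>n. real (card (A2 n))) at_top F"
      "filterlim (\<lambda>n. real (card (A3 n))) at_top F"
    and a: "(a \<longlongrightarrow> a0) F"
    and G: "continuous_on UNIV G"
  shows "((\<lambda>n. block_gibbs \<beta> (a n) (A1 n) (A2 n) (A3 n) G) \<longlongrightarrow>
    sign_average (\<lambda>v. coupling a0 v * G v) (m_star \<beta>, m_star \<beta>, m_star \<beta>) /
    sign_average (coupling a0) (m_star \<beta>, m_star \<beta>, m_star \<beta>)) F"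
  unfolding block_gibbs_def
proof (rule tendsto_divide)
  show "((\<lambda>n. indep_mean \<beta> (A1 n) (A2 n) (A3 n) (coupling (a n))) \<longlongrightarrow>
      sign_average (coupling a0) (m_star \<beta>, m_star \<beta>, m_star \<beta>)) F"
    using indep_mean_coupling_tendsto[OF beta fin card a, of "\<lambda>_. 1"] by simp
  have "0 < sign_average (coupling a0) (m_star \<beta>, m_star \<beta>, m_star \<beta>)"
    unfolding sign_average_def by (simp add: add_pos_pos)
  then show "sign_average (coupling a0) (m_star \<beta>, m_star \<beta>, m_star \<beta>) \<noteq> 0" by simp
qed (rule indep_mean_coupling_tendsto[OF beta fin card a G])

section \<open>Strong coupling\<close>

lemma block_gibbs_mono:
  assumes "finite A1" "finite A2" "finite A3"
    "\<And>x y z. \<bar>x\<bar> \<le> 1 \<Longrightarrow> \<bar>y\<bar> \<le> 1 \<Longrightarrow> \<bar>z\<bar> \<le> 1 \<Longrightarrow> F (x, y, z) \<le> G (x, y, z)"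
  shows "block_gibbs \<beta> a A1 A2 A3 F \<le> block_gibbs \<beta> a A1 A2 A3 G"
  unfolding block_gibbs_def using assms indep_mean_coupling_pos[OF assms(1-3), of \<beta> a]
  by (intro divide_right_mono indep_mean_mono mult_left_mono) (auto simp: less_imp_le)

lemma block_gibbs_add:
  "block_gibbs \<beta> a A1 A2 A3 (\<lambda>v. F v + G v) = block_gibbs \<beta> a A1 A2 A3 F + block_gibbs \<beta> a A1 A2 A3 G"
  unfolding block_gibbs_def distrib_left indep_mean_add by (rule add_divide_distrib)

lemma block_gibbs_cmult:
  "block_gibbs \<beta> a A1 A2 A3 (\<lambda>v. c * F v) = c * block_gibbs \<beta> a A1 A2 A3 F"
  unfolding block_gibbs_def mult.left_commute[of _ c] indep_mean_cmult by simp

lemma block_gibbs_flip: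
  assumes "finite A1" "finite A2" "finite A3"
  shows "block_gibbs \<beta> a A1 A2 A3 (\<lambda>(x, y, z). F (- x, - y, - z)) = block_gibbs \<beta> a A1 A2 A3 F"
proof -
  have "(\<lambda>v. coupling a v * (\<lambda>(x, y, z). F (- x, - y, - z)) v) =
      (\<lambda>(x, y, z). (\<lambda>v. coupling a v * F v) (-1 * x, -1 * y, -1 * z))"
    by (auto simp: coupling_def algebra_simps)
  then show ?thesis
    unfolding block_gibbs_def
    using indep_mean_flip[OF assms, of "-1" "-1" "-1" \<beta> "\<lambda>v. coupling a v * F v"] by simp
qed

lemma coupling_bounds:
  assumes "0 \<le> a" "\<bar>x\<bar> \<le> 1" "\<bar>y\<bar> \<le> 1" "\<bar>z\<bar> \<le> 1"
  shows "exp (- (2 * a)) \<le> coupling a (x, y, z)" "coupling a (x, y, z) \<le> exp (2 * a)"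
proof -
  have "\<bar>y * (x + z)\<bar> \<le> 1 * 2" unfolding abs_mult using assms by (intro mult_mono) auto
  then have "a * \<bar>y * (x + z)\<bar> \<le> a * 2" using assms(1) by (intro mult_left_mono) auto
  moreover have "a * \<bar>y * (x + z)\<bar> = \<bar>a * (y * (x + z))\<bar>" using assms(1) by (simp add: abs_mult)
  ultimately show "exp (- (2 * a)) \<le> coupling a (x, y, z)" "coupling a (x, y, z) \<le> exp (2 * a)"
    by (auto simp: coupling_def abs_le_iff)
qed

text \<open>The factor \<open>exp (a m2 (m1 + m3))\<close> lies between \<open>exp (- 2 a)\<close> and \<open>exp (2 a)\<close>. This crude comparison is good enough for events that
  are exponentially unlikely at the scale of the outer blocks.\<close>

lemma block_gibbs_le_indep_mean:
  assumes fin: "finite A1" "finite A2" "finite A3" and a: "0 \<le> a" and f: "\<And>v. 0 \<le> f v"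
  shows "block_gibbs \<beta> a A1 A2 A3 f \<le> exp (4 * a) * indep_mean \<beta> A1 A2 A3 f"
proof -
  let ?E = "indep_mean \<beta> A1 A2 A3"
  have "?E (\<lambda>v. coupling a v * f v) \<le> ?E (\<lambda>v. exp (2 * a) * f v)"
    using coupling_bounds(2)[OF a] f by (intro indep_mean_mono fin mult_right_mono) auto
  moreover have "?E (\<lambda>_. exp (- (2 * a))) \<le> ?E (coupling a)"
    using coupling_bounds(1)[OF a] by (intro indep_mean_mono fin) auto
  moreover have "0 \<le> ?E f"
    using indep_mean_mono[OF fin, of "\<lambda>_. 0" f \<beta>] f fin by simp
  ultimately have "block_gibbs \<beta> a A1 A2 A3 f \<le> (exp (2 * a) * ?E f) / exp (- (2 * a))"
    unfolding block_gibbs_def by (intro frac_le) (auto simp: indep_mean_cmult fin)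
  also have "\<dots> = exp (2 * a) * exp (2 * a) * ?E f" by (simp add: exp_minus field_simps)
  also have "exp (2 * a) * exp (2 * a) = exp (4 * a)" by (simp flip: exp_add)
  finally show ?thesis .
qed

text \<open>With probability at least \<open>1/8\<close> given the absolute values, all three magnetizations are nonnegative, and
  then the exponent is at least \<open>2 a (m* - \<eta>)\<^sup>2\<close> if they are close to \<open>m*\<close>.\<close>

lemma indep_mean_coupling_lower:
  assumes fin: "finite A1" "finite A2" "finite A3" and a: "0 \<le> a" and \<eta>: "\<eta> < m_star \<beta>"
  shows "exp (2 * a * (m_star \<beta> - \<eta>)\<^sup>2) / 8 *
      (1 - curie_weiss \<beta> 0 A1 (off_m_star \<beta> \<eta>) - curie_weiss \<beta> 0 A2 (off_m_star \<beta> \<eta>) - curie_weiss \<beta> 0 A3 (off_m_star \<beta> \<eta>)) \<le>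
    indep_mean \<beta> A1 A2 A3 (coupling a)"
proof -
  let ?E = "indep_mean \<beta> A1 A2 A3" and ?r = "m_star \<beta> - \<eta>"
  let ?c = "exp (2 * a * ?r\<^sup>2) / 8"
  let ?on = "\<lambda>v. 1 - (\<lambda>(x, y, z). off_m_star \<beta> \<eta> x) v - (\<lambda>(x, y, z). off_m_star \<beta> \<eta> y) v - (\<lambda>(x, y, z). off_m_star \<beta> \<eta> z) v"
  have pt: "?c * ?on (x, y, z) \<le> sign_average (coupling a) (x, y, z)" for x y z
  proof (cases "\<bar>\<bar>x\<bar> - m_star \<beta>\<bar> < \<eta> \<and> \<bar>\<bar>y\<bar> - m_star \<beta>\<bar> < \<eta> \<and> \<bar>\<bar>z\<bar> - m_star \<beta>\<bar> < \<eta>")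
    case True
    then have "?r * (2 * ?r) \<le> \<bar>y\<bar> * (\<bar>x\<bar> + \<bar>z\<bar>)"
      using \<eta> by (intro mult_mono) auto
    from mult_left_mono[OF this a] have "2 * a * ?r\<^sup>2 \<le> a * (\<bar>y\<bar> * (\<bar>x\<bar> + \<bar>z\<bar>))"
      by (simp add: power2_eq_square algebra_simps)
    then have "exp (2 * a * ?r\<^sup>2) \<le> coupling a (\<bar>x\<bar>, \<bar>y\<bar>, \<bar>z\<bar>)"
      by (simp add: coupling_def)
    also have "\<dots> = (case (1, 1, 1) of (s1, s2, s3) \<Rightarrow> coupling a (s1 * \<bar>x\<bar>, s2 * \<bar>y\<bar>, s3 * \<bar>z\<bar>))" by simp
    also have "\<dots> \<le> (\<Sum>(s1, s2, s3)\<in>{-1, 1} \<times> {-1, 1} \<times> {-1, 1}. coupling a (s1 * \<bar>x\<bar>, s2 * \<bar>y\<bar>, s3 * \<bar>z\<bar>))"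
      by (rule member_le_sum) (auto simp: less_imp_le)
    also have "\<dots> = 8 * sign_average (coupling a) (\<bar>x\<bar>, \<bar>y\<bar>, \<bar>z\<bar>)"
      by (simp add: sign_average_def)
    finally show ?thesis using True by (simp add: sign_average_abs off_m_star_def)
  next
    case False
    then have "?on (x, y, z) \<le> 0" by (auto simp: off_m_star_def not_less)
    then have "?c * ?on (x, y, z) \<le> 0" by (intro mult_nonneg_nonpos) auto
    also have "0 \<le> sign_average (coupling a) (x, y, z)"
      unfolding sign_average_def by (simp add: less_imp_le add_pos_pos)
    finally show ?thesis .
  qed
  have "?E (\<lambda>v. ?c * ?on v) \<le> ?E (sign_average (coupling a))"
    using pt by (intro indep_mean_mono fin)
  then show ?thesis
    by (simp only: indep_mean_cmult indep_mean_diff indep_mean_const[OF fin]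
        indep_mean_coordinates[OF fin] indep_mean_sign_average[OF fin])
qed

definition outer_opposite :: "real \<Rightarrow> real \<Rightarrow> real \<times> real \<times> real \<Rightarrow> real" where
  "outer_opposite \<beta> \<eta> = (\<lambda>(x, y, z).
     of_bool (\<bar>\<bar>x\<bar> - m_star \<beta>\<bar> < \<eta> \<and> \<bar>\<bar>z\<bar> - m_star \<beta>\<bar> < \<eta> \<and> x * z < 0))"

text \<open>When the outer magnetizations nearly cancel, the middle block feels almost no field.\<close>

lemma indep_mean_outer_opposite:
  assumes fin: "finite A1" "finite A2" "finite A3" and a: "0 \<le> a"
  shows "indep_mean \<beta> A1 A2 A3 (\<lambda>v. coupling a v * outer_opposite \<beta> \<eta> v) \<le> exp (2 * a * \<eta>)"
proof -
  have "indep_mean \<beta> A1 A2 A3 (\<lambda>v. coupling a v * outer_opposite \<beta> \<eta> v) \<le> indep_mean \<beta> A1 A2 A3 (\<lambda>_. exp (2 * a * \<eta>))"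
  proof (intro indep_mean_mono fin)
    fix x y z :: real assume "\<bar>y\<bar> \<le> 1"
    show "coupling a (x, y, z) * outer_opposite \<beta> \<eta> (x, y, z) \<le> exp (2 * a * \<eta>)"
    proof (cases "\<bar>\<bar>x\<bar> - m_star \<beta>\<bar> < \<eta> \<and> \<bar>\<bar>z\<bar> - m_star \<beta>\<bar> < \<eta> \<and> x * z < 0")
      case True
      then have "\<bar>x + z\<bar> \<le> 2 * \<eta>" by (auto simp: mult_less_0_iff abs_if split: if_splits)
      then have "\<bar>y * (x + z)\<bar> \<le> 1 * (2 * \<eta>)"
        unfolding abs_mult using \<open>\<bar>y\<bar> \<le> 1\<close> by (intro mult_mono) auto
      then have "y * (x + z) \<le> 2 * \<eta>" by simp
      from mult_left_mono[OF this a] True show ?thesis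
        by (simp add: coupling_def outer_opposite_def mult.left_commute mult.commute)
    qed (auto simp: outer_opposite_def)
  qed
  then show ?thesis using fin by simp
qed

definition middle_off :: "real \<Rightarrow> real \<Rightarrow> real \<Rightarrow> real \<Rightarrow> real \<Rightarrow> real \<times> real \<times> real \<Rightarrow> real" where
  "middle_off \<beta> \<eta> m \<epsilon> s = (\<lambda>(x, y, z).
     of_bool (\<bar>x - s * m_star \<beta>\<bar> < \<eta> \<and> \<bar>z - s * m_star \<beta>\<bar> < \<eta> \<and> \<epsilon> \<le> \<bar>y - s * m\<bar>))"

text \<open>Given \<open>m1\<close> and \<open>m3\<close>, the middle block is a Curie-Weiss model in the field \<open>a (m1 + m3) / |B2|\<close>, which is
  within \<open>\<theta>\<close> of \<open>2 s \<kappa> m*\<close> on this event; flipping the middle block reduces \<open>s = -1\<close> to \<open>s = 1\<close>.\<close>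

lemma block_gibbs_middle_off:
  assumes fin: "finite A1" "finite A2" "finite A3" and ne: "A2 \<noteq> {}" and s: "s \<in> {-1, 1}"
    and \<kappa>: "0 < \<kappa>" and a: "2 * \<bar>a / real (card A2) - \<kappa>\<bar> + 2 * \<kappa> * \<eta> \<le> \<theta>"
    and conc: "curie_weiss \<beta> (2 * \<kappa> * m_star \<beta>) A2 (\<lambda>y. of_bool (\<epsilon> \<le> \<bar>y - m\<bar>)) \<le> K" and K: "0 \<le> K"
  shows "block_gibbs \<beta> a A1 A2 A3 (middle_off \<beta> \<eta> m \<epsilon> s) \<le> K * exp (2 * \<theta> * real (card A2))"
proof -
  let ?b = "real (card A2)"
  let ?R = "K * exp (2 * \<theta> * ?b)"
  have b: "0 < ?b" using fin ne by (simp add: card_gt_0_iff)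
  have inner: "curie_weiss \<beta> 0 A2 (\<lambda>y. coupling a (x, y, z) * middle_off \<beta> \<eta> m \<epsilon> s (x, y, z)) \<le>
      curie_weiss \<beta> 0 A2 (\<lambda>y. ?R * coupling a (x, y, z))" if "\<bar>x\<bar> \<le> 1" "\<bar>z\<bar> \<le> 1" for x z
  proof (cases "\<bar>x - s * m_star \<beta>\<bar> < \<eta> \<and> \<bar>z - s * m_star \<beta>\<bar> < \<eta>")
    case True
    define h where "h = a / ?b * (s * (x + z))"
    have ss: "s * s = 1" "\<bar>s\<bar> = 1" using s by auto
    have "h - 2 * \<kappa> * m_star \<beta> = (a / ?b - \<kappa>) * (s * (x + z)) + \<kappa> * (s * ((x - s * m_star \<beta>) + (z - s * m_star \<beta>)))"
      using s by (auto simp: h_def algebra_simps)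
    also have "\<bar>\<dots>\<bar> \<le> \<bar>a / ?b - \<kappa>\<bar> * (1 * 2) + \<kappa> * (1 * (2 * \<eta>))"
      using True that \<kappa> ss by (intro order_trans[OF abs_triangle_ineq] add_mono)
        (auto simp: abs_mult intro!: mult_left_mono)
    finally have h: "\<bar>h - 2 * \<kappa> * m_star \<beta>\<bar> \<le> \<theta>" using a by (simp add: mult_ac)
    have exp_h: "coupling a (x, s * y, z) = exp (?b * (h * y))" for y
      using b by (simp add: coupling_def h_def mult_ac)
    have dist: "\<bar>s * y - s * m\<bar> = \<bar>y - m\<bar>" for y
      using s by (auto simp: abs_minus_commute)
    have "curie_weiss \<beta> 0 A2 (\<lambda>y. coupling a (x, y, z) * middle_off \<beta> \<eta> m \<epsilon> s (x, y, z)) =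
        curie_weiss \<beta> 0 A2 (\<lambda>y. exp (?b * (h * y)) * of_bool (\<epsilon> \<le> \<bar>y - m\<bar>))"
      using True
      by (subst curie_weiss_flip_sign[OF fin(2) s, symmetric]) (simp add: exp_h middle_off_def dist)
    also have "\<dots> \<le> ?R * curie_weiss \<beta> 0 A2 (\<lambda>y. exp (?b * (h * y)))"
      by (rule curie_weiss_perturbed_field[OF fin(2) h _ conc K]) simp
    also have "\<dots> = ?R * curie_weiss \<beta> 0 A2 (\<lambda>y. coupling a (x, s * y, z))"
      by (simp only: exp_h)
    also have "\<dots> = ?R * curie_weiss \<beta> 0 A2 (\<lambda>y. coupling a (x, y, z))"
      by (simp only: curie_weiss_flip_sign[OF fin(2) s, of \<beta> "\<lambda>y. coupling a (x, y, z)"])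
    finally show ?thesis by (simp add: curie_weiss_cmult)
  next
    case False
    then have [simp]: "middle_off \<beta> \<eta> m \<epsilon> s (x, y, z) = 0" for y by (auto simp: middle_off_def)
    show ?thesis using K fin by (intro curie_weiss_mono) (auto simp: less_imp_le)
  qed
  have "indep_mean \<beta> A1 A2 A3 (\<lambda>v. coupling a v * middle_off \<beta> \<eta> m \<epsilon> s v) \<le>
      indep_mean \<beta> A1 A2 A3 (\<lambda>v. ?R * coupling a v)"
    unfolding indep_mean_def by (intro curie_weiss_mono fin inner)
  then show ?thesis
    using indep_mean_coupling_pos[OF fin, of \<beta> a]
    by (simp add: block_gibbs_def indep_mean_cmult pos_divide_le_eq)
qed

text \<open>There are only these ways to stay away from both limit points: an outer block misses \<open>\<plusminus>m*\<close>, the outer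
  blocks disagree in sign, or the middle block does not follow their common sign.\<close>

lemma off_points_cases:
  assumes "\<eta> \<le> d / 3" "\<eta> < m_star \<beta>"
  shows "of_bool (\<forall>p\<in>{(m_star \<beta>, m, m_star \<beta>), (- m_star \<beta>, - m, - m_star \<beta>)}. d \<le> dist (x, y, z) p) \<le>
    off_m_star \<beta> \<eta> x + off_m_star \<beta> \<eta> z + outer_opposite \<beta> \<eta> (x, y, z) +
    middle_off \<beta> \<eta> m (d / 3) 1 (x, y, z) + middle_off \<beta> \<eta> m (d / 3) (-1) (x, y, z)"
    (is "of_bool ?bad \<le> ?x + ?z + ?opp + ?plus + ?minus")
proof (cases ?bad)
  case True
  have nonneg: "0 \<le> ?x" "0 \<le> ?z" "0 \<le> ?opp" "0 \<le> ?plus" "0 \<le> ?minus"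
    by (auto simp: off_m_star_def outer_opposite_def middle_off_def)
  have "x * z < 0 \<or> \<bar>x - m_star \<beta>\<bar> < \<eta> \<and> \<bar>z - m_star \<beta>\<bar> < \<eta> \<or> \<bar>x + m_star \<beta>\<bar> < \<eta> \<and> \<bar>z + m_star \<beta>\<bar> < \<eta>"
    if "\<bar>\<bar>x\<bar> - m_star \<beta>\<bar> < \<eta>" "\<bar>\<bar>z\<bar> - m_star \<beta>\<bar> < \<eta>"
    using that assms(2) by (auto simp: mult_less_0_iff abs_if split: if_splits)
  then consider "\<eta> \<le> \<bar>\<bar>x\<bar> - m_star \<beta>\<bar>" | "\<eta> \<le> \<bar>\<bar>z\<bar> - m_star \<beta>\<bar>"
    | "\<bar>\<bar>x\<bar> - m_star \<beta>\<bar> < \<eta>" "\<bar>\<bar>z\<bar> - m_star \<beta>\<bar> < \<eta>" "x * z < 0"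
    | "\<bar>x - m_star \<beta>\<bar> < \<eta>" "\<bar>z - m_star \<beta>\<bar> < \<eta>"
    | "\<bar>x + m_star \<beta>\<bar> < \<eta>" "\<bar>z + m_star \<beta>\<bar> < \<eta>"
    by (meson not_le)
  then have "1 \<le> ?x \<or> 1 \<le> ?z \<or> 1 \<le> ?opp \<or> 1 \<le> ?plus \<or> 1 \<le> ?minus"
  proof cases
    case 4
    moreover from this have "d / 3 \<le> \<bar>y - m\<bar>"
      using dist_triple_le[of x y z "m_star \<beta>" m "m_star \<beta>"] assms(1) True by auto
    ultimately have "?plus = 1" by (simp add: middle_off_def)
    then show ?thesis by simp
  next
    case 5
    moreover from this have "d / 3 \<le> \<bar>y + m\<bar>"
      using dist_triple_le[of x y z "- m_star \<beta>" "- m" "- m_star \<beta>"] assms(1) True by auto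
    ultimately have "?minus = 1" by (simp add: middle_off_def)
    then show ?thesis by simp
  qed (simp_all add: off_m_star_def outer_opposite_def)
  moreover have "of_bool ?bad = (1 :: real)" unfolding of_bool_def by (rule if_P[OF True])
  ultimately show ?thesis using nonneg by linarith
next
  case False
  have "of_bool ?bad = (0 :: real)" unfolding of_bool_def by (rule if_not_P[OF False])
  moreover have "0 \<le> ?x" "0 \<le> ?z" "0 \<le> ?opp" "0 \<le> ?plus" "0 \<le> ?minus"
    by (auto simp: off_m_star_def outer_opposite_def middle_off_def)
  ultimately show ?thesis by linarith
qed

text \<open>The factor \<open>exp (4 a)\<close> of \<open>block_gibbs_le_indep_mean\<close> is negligible against the concentration of a block
  that is much larger than \<open>a\<close>.\<close>

lemma exp_mult_off_m_star_tendsto_0: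
  assumes "1 < \<beta>" "0 < \<eta>" and fin: "\<forall>\<^sub>F n in F. finite (A n)"
    and card: "filterlim (\<lambda>n. real (card (A n))) at_top F"
    and a: "((\<lambda>n. a n / real (card (A n))) \<longlongrightarrow> 0) F"
  shows "((\<lambda>n. exp (4 * a n) * curie_weiss \<beta> 0 (A n) (off_m_star \<beta> \<eta>)) \<longlongrightarrow> 0) F"
proof -
  obtain K \<delta> where K: "0 < K" "0 < \<delta>" and bound: "\<And>A :: 'b set. finite A \<Longrightarrow>
       curie_weiss \<beta> 0 A (\<lambda>x. of_bool (\<eta> \<le> \<bar>\<bar>x\<bar> - m_star \<beta>\<bar>)) \<le> K * exp (- \<delta> * real (card A))"
    using curie_weiss_off_m_star[OF assms(1,2)] by blast
  have \<delta>: "0 < \<delta> / 2" "0 < \<delta> / 8" using K by auto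
  show ?thesis
  proof (rule tendsto_sandwich[OF _ _ tendsto_const exp_decay_tendsto_0[OF \<delta>(1) card]])
    show "\<forall>\<^sub>F n in F. 0 \<le> exp (4 * a n) * curie_weiss \<beta> 0 (A n) (off_m_star \<beta> \<eta>)"
      using fin
    proof eventually_elim
      case (elim n)
      then show ?case
        using curie_weiss_mono[OF elim, of "\<lambda>_. 0" "off_m_star \<beta> \<eta>" \<beta> 0] by (simp add: off_m_star_def)
    qed
    show "\<forall>\<^sub>F n in F. exp (4 * a n) * curie_weiss \<beta> 0 (A n) (off_m_star \<beta> \<eta>) \<le> K * exp (- (\<delta> / 2) * real (card (A n)))"
      using fin order_tendstoD(2)[OF a \<delta>(2)] filterlim_at_top_dense[THEN iffD1, OF card, rule_format, of 0]
    proof eventually_elim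
      case (elim n)
      have "4 * a n \<le> \<delta> / 2 * real (card (A n))" using elim(2,3) by (simp add: field_simps)
      then have "exp (4 * a n) * exp (- \<delta> * real (card (A n))) \<le> exp (- (\<delta> / 2) * real (card (A n)))"
        by (simp flip: exp_add)
      then have le: "K * (exp (4 * a n) * exp (- \<delta> * real (card (A n)))) \<le> K * exp (- (\<delta> / 2) * real (card (A n)))"
        using K by (intro mult_left_mono) auto
      have "exp (4 * a n) * curie_weiss \<beta> 0 (A n) (off_m_star \<beta> \<eta>) \<le> exp (4 * a n) * (K * exp (- \<delta> * real (card (A n))))"
        unfolding off_m_star_def[abs_def] by (intro mult_left_mono bound elim) auto
      also have "\<dots> = K * (exp (4 * a n) * exp (- \<delta> * real (card (A n))))"
        by (rule mult.left_commute)
      also note le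
      finally show ?case .
    qed
  qed
qed

lemma block_gibbs_off_points_tendsto_0:
  assumes beta: "1 < \<beta>"
    and fin: "\<forall>\<^sub>F n in F. finite (A1 n) \<and> finite (A2 n) \<and> finite (A3 n)"
    and card: "filterlim (\<lambda>n. real (card (A1 n))) at_top F" "filterlim (\<lambda>n. real (card (A2 n))) at_top F"
      "filterlim (\<lambda>n. real (card (A3 n))) at_top F"
    and a1: "((\<lambda>n. a n / real (card (A1 n))) \<longlongrightarrow> 0) F" and a3: "((\<lambda>n. a n / real (card (A3 n))) \<longlongrightarrow> 0) F"
    and a2: "((\<lambda>n. a n / real (card (A2 n))) \<longlongrightarrow> \<kappa>) F" and \<kappa>: "0 < \<kappa>" and d: "0 < d"
  defines "m \<equiv> (GREATEST x. x = tanh (\<beta> * x + 2 * \<kappa> * m_star \<beta>))"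
  shows "((\<lambda>n. block_gibbs \<beta> (a n) (A1 n) (A2 n) (A3 n) (\<lambda>v. of_bool
    (\<forall>p\<in>{(m_star \<beta>, m, m_star \<beta>), (- m_star \<beta>, - m, - m_star \<beta>)}. d \<le> dist v p))) \<longlongrightarrow> 0) F"
proof -
  let ?m = "m_star \<beta>" and ?G = "\<lambda>n. block_gibbs \<beta> (a n) (A1 n) (A2 n) (A3 n)"
  note ms = m_star_props[OF beta]
  have h0: "0 < 2 * \<kappa> * ?m" using \<kappa> ms by simp
  have "0 < \<beta>" "0 < d / 3" using beta d by auto
  from curie_weiss_off_field_maximizer[OF this(1) h0 this(2), folded m_def]
  obtain K \<delta> where K: "0 < K" "0 < \<delta>" and bound: "\<And>A :: 'b set. finite A \<Longrightarrow>
       curie_weiss \<beta> (2 * \<kappa> * ?m) A (\<lambda>x. of_bool (d / 3 \<le> \<bar>x - m\<bar>)) \<le> K * exp (- \<delta> * real (card A))"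
    by blast
  \<comment> \<open>With \<open>\<theta> = \<delta> / 4\<close> the field error \<open>2 * \<theta>\<close> uses up half of the rate \<open>\<delta>\<close> of the middle block. The three
    bounds on \<open>\<eta>\<close> leave a third of the distance \<open>d\<close> to the middle coordinate, ensure
    \<open>\<eta> < (m* - \<eta>)\<^sup>2\<close>, and keep the part of the field error due to the outer blocks at most \<open>\<theta> / 2\<close>.\<close>
  define \<theta> where "\<theta> = \<delta> / 4"
  define \<eta> where "\<eta> = Min {d / 3, ?m\<^sup>2 / 4, \<theta> / (4 * \<kappa>)}"
  have \<eta>: "0 < \<eta>" "\<eta> \<le> d / 3" "\<eta> \<le> ?m\<^sup>2 / 4" "\<eta> \<le> \<theta> / (4 * \<kappa>)"
    using d ms \<kappa> K by (auto simp: \<eta>_def \<theta>_def)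
  have "?m\<^sup>2 \<le> ?m * 1" unfolding power2_eq_square using ms by (intro mult_left_mono) auto
  then have \<eta>_m: "\<eta> \<le> ?m / 4" "\<eta> < ?m" using \<eta> ms by auto
  \<comment> \<open>The rate at which aligned outer blocks win over opposite ones.\<close>
  define \<rho> where "\<rho> = 2 * ((?m - \<eta>)\<^sup>2 - \<eta>)"
  have "(3 / 4 * ?m)\<^sup>2 \<le> (?m - \<eta>)\<^sup>2" using \<eta>_m ms by (intro power_mono) auto
  then have "9 / 16 * ?m\<^sup>2 \<le> (?m - \<eta>)\<^sup>2" by (simp add: power_mult_distrib power_divide)
  moreover have "\<eta> < 9 / 16 * ?m\<^sup>2"
    using \<eta>(3) zero_less_power[OF ms(1), of 2] by linarith
  ultimately have "\<eta> < (?m - \<eta>)\<^sup>2" by (rule less_le_trans[rotated])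
  then have \<rho>: "0 < \<rho>" by (simp add: \<rho>_def)
  have a_top: "filterlim a at_top F"
  proof -
    have "filterlim (\<lambda>n. a n / real (card (A2 n)) * real (card (A2 n))) at_top F"
      by (rule filterlim_tendsto_pos_mult_at_top[OF a2 \<kappa> card(2)])
    then show ?thesis
      by (rule filterlim_mono_eventually[OF _ order_refl order_refl])
        (use filterlim_at_top_dense[THEN iffD1, OF card(2), rule_format, of 0] in \<open>eventually_elim, simp\<close>)
  qed
  let ?off_m_star = "\<lambda>n. curie_weiss \<beta> 0 (A1 n) (off_m_star \<beta> \<eta>) + curie_weiss \<beta> 0 (A2 n) (off_m_star \<beta> \<eta>) + curie_weiss \<beta> 0 (A3 n) (off_m_star \<beta> \<eta>)"
  have off_0: "((\<lambda>n. curie_weiss \<beta> 0 (A n) (off_m_star \<beta> \<eta>)) \<longlongrightarrow> 0) F"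
    if "\<forall>\<^sub>F n in F. finite (A n)" "filterlim (\<lambda>n. real (card (A n))) at_top F" for A :: "'a \<Rightarrow> 'b set"
    unfolding off_m_star_def[abs_def] using that \<eta> by (intro curie_weiss_off_m_star_tendsto_0 beta) auto
  have "(?off_m_star \<longlongrightarrow> 0) F"
    by (intro tendsto_add_zero off_0 card eventually_mono[OF fin]) auto
  then have half: "\<forall>\<^sub>F n in F. ?off_m_star n < 1 / 2" by (rule order_tendstoD) simp
  let ?upper = "\<lambda>n. exp (4 * a n) * curie_weiss \<beta> 0 (A1 n) (off_m_star \<beta> \<eta>) + exp (4 * a n) * curie_weiss \<beta> 0 (A3 n) (off_m_star \<beta> \<eta>) +
    16 * exp (- \<rho> * a n) + K * exp (- (\<delta> / 2) * real (card (A2 n))) + K * exp (- (\<delta> / 2) * real (card (A2 n)))"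
  show ?thesis
  proof (rule tendsto_sandwich[OF _ _ tendsto_const])
    show "(?upper \<longlongrightarrow> 0) F"
      using K by (intro tendsto_add_zero exp_mult_off_m_star_tendsto_0 exp_decay_tendsto_0 beta \<eta> card a1 a3 a_top \<rho> eventually_mono[OF fin]) auto
    show "\<forall>\<^sub>F n in F. 0 \<le> ?G n (\<lambda>v. of_bool (\<forall>p\<in>{(?m, m, ?m), (- ?m, - m, - ?m)}. d \<le> dist v p))"
      using fin
    proof eventually_elim
      case (elim n)
      then show ?case
        using block_gibbs_mono[of "A1 n" "A2 n" "A3 n" "\<lambda>_. 0" "\<lambda>v. of_bool (\<forall>p\<in>{(?m, m, ?m), (- ?m, - m, - ?m)}. d \<le> dist v p)" \<beta> "a n"]
        by (simp add: block_gibbs_def indep_mean_const)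
    qed
    have small: "\<forall>\<^sub>F n in F. \<bar>a n / real (card (A2 n)) - \<kappa>\<bar> < \<theta> / 4"
      using tendstoD[OF a2, of "\<theta> / 4"] K by (simp add: dist_real_def \<theta>_def)
    show "\<forall>\<^sub>F n in F. ?G n (\<lambda>v. of_bool (\<forall>p\<in>{(?m, m, ?m), (- ?m, - m, - ?m)}. d \<le> dist v p)) \<le> ?upper n"
      using fin half small filterlim_at_top_dense[THEN iffD1, OF card(2), rule_format, of 0]
        filterlim_at_top_dense[THEN iffD1, OF a_top, rule_format, of 0]
    proof eventually_elim
      case (elim n)
      have f: "finite (A1 n)" "finite (A2 n)" "finite (A3 n)" using elim by auto
      have a: "0 \<le> a n" using elim by simp
      have "?G n (\<lambda>v. of_bool (\<forall>p\<in>{(?m, m, ?m), (- ?m, - m, - ?m)}. d \<le> dist v p)) \<le>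
        ?G n (\<lambda>v. (\<lambda>(x, y, z). off_m_star \<beta> \<eta> x) v + (\<lambda>(x, y, z). off_m_star \<beta> \<eta> z) v + outer_opposite \<beta> \<eta> v +
          middle_off \<beta> \<eta> m (d / 3) 1 v + middle_off \<beta> \<eta> m (d / 3) (-1) v)"
        using off_points_cases[OF \<eta>(2) \<eta>_m(2), of m] by (intro block_gibbs_mono f) simp
      also have "\<dots> \<le> ?upper n"
        unfolding block_gibbs_add
      proof (intro add_mono)
        show "?G n (\<lambda>(x, y, z). off_m_star \<beta> \<eta> x) \<le> exp (4 * a n) * curie_weiss \<beta> 0 (A1 n) (off_m_star \<beta> \<eta>)"
          "?G n (\<lambda>(x, y, z). off_m_star \<beta> \<eta> z) \<le> exp (4 * a n) * curie_weiss \<beta> 0 (A3 n) (off_m_star \<beta> \<eta>)"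
          unfolding indep_mean_coordinates[OF f, symmetric]
          by (rule block_gibbs_le_indep_mean[OF f a]; simp add: off_m_star_def split_beta)+
        have "exp (2 * a n * (?m - \<eta>)\<^sup>2) / 8 * (1 / 2) \<le> exp (2 * a n * (?m - \<eta>)\<^sup>2) / 8 *
            (1 - curie_weiss \<beta> 0 (A1 n) (off_m_star \<beta> \<eta>) - curie_weiss \<beta> 0 (A2 n) (off_m_star \<beta> \<eta>) - curie_weiss \<beta> 0 (A3 n) (off_m_star \<beta> \<eta>))"
          using elim(2) by (intro mult_left_mono) auto
        also note indep_mean_coupling_lower[OF f a \<eta>_m(2)]
        finally have "?G n (outer_opposite \<beta> \<eta>) \<le> exp (2 * a n * \<eta>) / (exp (2 * a n * (?m - \<eta>)\<^sup>2) / 8 * (1 / 2))"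
          unfolding block_gibbs_def
          using indep_mean_outer_opposite[OF f a, of \<beta> \<eta>] by (intro frac_le) auto
        also have "\<dots> = 16 * exp (- \<rho> * a n)"
          by (simp add: \<rho>_def exp_diff[symmetric] algebra_simps) (simp add: exp_diff)
        finally show "?G n (outer_opposite \<beta> \<eta>) \<le> 16 * exp (- \<rho> * a n)" .
        have close: "2 * \<bar>a n / real (card (A2 n)) - \<kappa>\<bar> + 2 * \<kappa> * \<eta> \<le> \<theta>"
          using elim(3) \<eta>(4) \<kappa> by (simp add: field_simps)
        have ne: "A2 n \<noteq> {}" using elim(4) by auto
        have decay: "K * exp (- \<delta> * real (card (A2 n))) * exp (2 * \<theta> * real (card (A2 n))) =
            K * exp (- (\<delta> / 2) * real (card (A2 n)))"
          by (simp add: \<theta>_def mult.assoc flip: exp_add)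
        have "?G n (middle_off \<beta> \<eta> m (d / 3) s) \<le> K * exp (- (\<delta> / 2) * real (card (A2 n)))"
          if "s \<in> {-1, 1}" for s
          unfolding decay[symmetric]
          using K(1) by (intro block_gibbs_middle_off[OF f ne that \<kappa> close bound[OF f(2)]]) simp
        then show "?G n (middle_off \<beta> \<eta> m (d / 3) 1) \<le> K * exp (- (\<delta> / 2) * real (card (A2 n)))"
          "?G n (middle_off \<beta> \<eta> m (d / 3) (-1)) \<le> K * exp (- (\<delta> / 2) * real (card (A2 n)))"
          by simp_all
      qed
      finally show ?case .
    qed
  qed
qed

text \<open>The global flip preserves the coupled model, so the test function may be replaced by its even part, which
  has the same value at both limit points.\<close>

lemma block_gibbs_tendsto_strong_coupling:
  assumes beta: "1 < \<beta>"
    and fin: "\<forall>\<^sub>F n in F. finite (A1 n) \<and> finite (A2 n) \<and> finite (A3 n)"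
    and card: "filterlim (\<lambda>n. real (card (A1 n))) at_top F" "filterlim (\<lambda>n. real (card (A2 n))) at_top F"
      "filterlim (\<lambda>n. real (card (A3 n))) at_top F"
    and a1: "((\<lambda>n. a n / real (card (A1 n))) \<longlongrightarrow> 0) F" and a3: "((\<lambda>n. a n / real (card (A3 n))) \<longlongrightarrow> 0) F"
    and a2: "((\<lambda>n. a n / real (card (A2 n))) \<longlongrightarrow> \<kappa>) F" and \<kappa>: "0 < \<kappa>"
    and G: "continuous_on UNIV G"
  defines "m \<equiv> (GREATEST x. x = tanh (\<beta> * x + 2 * \<kappa> * m_star \<beta>))"
  shows "((\<lambda>n. block_gibbs \<beta> (a n) (A1 n) (A2 n) (A3 n) G) \<longlongrightarrow>
    (G (m_star \<beta>, m, m_star \<beta>) + G (- m_star \<beta>, - m, - m_star \<beta>)) / 2) F"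
proof -
  let ?Gs = "\<lambda>v. 1 / 2 * (G v + (\<lambda>(x, y, z). G (- x, - y, - z)) v)"
  have "continuous_on UNIV (\<lambda>v. G (- fst v, - fst (snd v), - snd (snd v)))"
    by (intro continuous_on_compose2[OF G] continuous_intros) auto
  then have cont: "continuous_on UNIV ?Gs"
    unfolding split_beta by (intro continuous_intros G)
  have "((\<lambda>n. block_gibbs \<beta> (a n) (A1 n) (A2 n) (A3 n) ?Gs) \<longlongrightarrow>
    (G (m_star \<beta>, m, m_star \<beta>) + G (- m_star \<beta>, - m, - m_star \<beta>)) / 2) F"
  proof (rule block_gibbs_concentrated[OF fin _ _ cont, where P = "{(m_star \<beta>, m, m_star \<beta>), (- m_star \<beta>, - m, - m_star \<beta>)}"])
    fix d :: real assume "0 < d"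
    then show "((\<lambda>n. block_gibbs \<beta> (a n) (A1 n) (A2 n) (A3 n) (\<lambda>v. of_bool
      (\<forall>p\<in>{(m_star \<beta>, m, m_star \<beta>), (- m_star \<beta>, - m, - m_star \<beta>)}. d \<le> dist v p))) \<longlongrightarrow> 0) F"
      unfolding m_def by (intro block_gibbs_off_points_tendsto_0 beta fin card a1 a3 a2 \<kappa>)
  qed auto
  then show ?thesis
    by (rule Lim_transform_eventually)
      (use fin in \<open>eventually_elim, simp only: block_gibbs_cmult block_gibbs_add block_gibbs_flip, simp\<close>)
qed

section \<open>The Gibbs measure as a coupled triple of blocks\<close>

lemma bij_betw_merge_signs:
  assumes "A \<inter> B = {}"
  shows "bij_betw (merge A B) (signs A \<times> signs B) (signs (A \<union> B))"
proof (rule bij_betwI[where g = "\<lambda>\<rho>. (restrict \<rho> A, restrict \<rho> B)"])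
  show "merge A B \<in> signs A \<times> signs B \<rightarrow> signs (A \<union> B)"
    using assms by (auto simp: signs_def PiE_cancel_merge)
  show "(\<lambda>\<rho>. (restrict \<rho> A, restrict \<rho> B)) \<in> signs (A \<union> B) \<rightarrow> signs A \<times> signs B"
    by (auto simp: signs_def)
  show "(\<lambda>\<rho>. (restrict \<rho> A, restrict \<rho> B)) (merge A B p) = p" if "p \<in> signs A \<times> signs B" for p
    using that assms by (auto simp: signs_def PiE_restrict)
  show "merge A B ((\<lambda>\<rho>. (restrict \<rho> A, restrict \<rho> B)) \<rho>) = \<rho>" if "\<rho> \<in> signs (A \<union> B)" for \<rho>
    using that by (simp add: signs_def PiE_restrict)
qed

lemma mean_spin_merge:
  assumes "A \<inter> B = {}"
  shows "mean_spin A (merge A B (\<sigma>, \<tau>)) = mean_spin A \<sigma>" "mean_spin B (merge A B (\<sigma>, \<tau>)) = mean_spin B \<tau>"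
  using assms by (auto simp: mean_spin_def intro!: arg_cong2[where f = "(/)"] sum.cong)

lemma mean_spin_merge_subset:
  assumes "A \<inter> B = {}" "C \<subseteq> B"
  shows "mean_spin C (merge A B (\<sigma>, \<tau>)) = mean_spin C \<tau>"
  unfolding mean_spin_def using assms by (intro arg_cong2[where f = "(/)"] sum.cong refl merge_apply) auto

lemma mag_vector_eq: "mag_vector B \<sigma> = (mean_spin (B 1) \<sigma>, mean_spin (B 2) \<sigma>, mean_spin (B 3) \<sigma>)"
  by (simp add: mag_vector_def block_mag_def mean_spin_def)

lemma three_block_partitionD:
  assumes "three_block_partition N bN B"
  shows "finite (B 1)" "finite (B 2)" "finite (B 3)" "B 1 \<union> (B 3 \<union> B 2) = {1..N}"
    "B 1 \<inter> (B 3 \<union> B 2) = {}" "B 3 \<inter> B 2 = {}"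
proof -
  have I: "{1..3} = {1, 2, 3 :: nat}" by auto
  show un: "B 1 \<union> (B 3 \<union> B 2) = {1..N}"
    using assms unfolding three_block_partition_def I by auto
  show "finite (B 1)" "finite (B 2)" "finite (B 3)"
    using un by (metis finite_Un finite_atLeastAtMost)+
  show "B 1 \<inter> (B 3 \<union> B 2) = {}" "B 3 \<inter> B 2 = {}"
    using assms unfolding three_block_partition_def I disjoint_family_on_def by auto
qed

text \<open>The two outer blocks have the same size, so both interactions have the same strength.\<close>

lemma exp_minus_hamiltonian:
  assumes "card (B 1) = card (B 3)"
  shows "exp (- hamiltonian B \<beta> \<alpha> \<sigma>) =
    curie_weiss_weight \<beta> 0 (B 1) \<sigma> * (curie_weiss_weight \<beta> 0 (B 3) \<sigma> * curie_weiss_weight \<beta> 0 (B 2) \<sigma>) *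
    coupling (\<alpha> * sqrt (real (card (B 1)) * real (card (B 2)))) (mag_vector B \<sigma>)"
proof -
  have I: "{1..3} = {1, 2, 3 :: nat}" by auto
  show ?thesis
    unfolding hamiltonian_def I mag_vector_eq curie_weiss_weight_def coupling_def block_mag_def mean_spin_def[symmetric]
    using assms by (simp add: algebra_simps flip: exp_add)
qed

text \<open>A spin configuration is the same as a triple of configurations on the blocks, and the factor \<open>2 ^ N\<close>
  cancels in the normalization.\<close>

lemma integral_mag_distr:
  assumes part: "three_block_partition N bN B" and f: "continuous_on UNIV (f :: _ \<Rightarrow> real)"
  shows "integral\<^sup>L (mag_distr N B \<beta> \<alpha>) f =
    block_gibbs \<beta> (\<alpha> * sqrt (real (card (B 1)) * real (card (B 2)))) (B 1) (B 2) (B 3) f"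
proof -
  note P = three_block_partitionD[OF part]
  define a where "a = \<alpha> * sqrt (real (card (B 1)) * real (card (B 2)))"
  have card: "card (B 1) = card (B 3)" using part by (simp add: three_block_partition_def)
  let ?w = "\<lambda>\<sigma>. exp (- hamiltonian B \<beta> \<alpha> \<sigma>)"
  let ?c = "1 / partition_function N B \<beta> \<alpha>"
  have Z: "0 \<le> partition_function N B \<beta> \<alpha>"
    unfolding partition_function_def by (intro sum_nonneg) auto
  have "integral\<^sup>L (mag_distr N B \<beta> \<alpha>) f = integral\<^sup>L (gibbs N B \<beta> \<alpha>) (\<lambda>\<sigma>. f (mag_vector B \<sigma>))"
    unfolding mag_distr_def using f
    by (intro integral_distr borel_measurable_continuous_onI) (simp_all add: gibbs_def point_measure_def)
  also have "\<dots> = (\<Sum>\<sigma>\<in>spins N. (?c * (?w \<sigma> / 2 ^ N)) *\<^sub>R f (mag_vector B \<sigma>))"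
    unfolding gibbs_def using Z by (intro lebesgue_integral_point_measure_finite finite_spins) auto
  also have "\<dots> = wmean (spins N) ?w (\<lambda>\<sigma>. f (mag_vector B \<sigma>))"
    unfolding wmean_def partition_function_def sum_divide_distrib[symmetric]
    by (simp add: sum_divide_distrib sum_distrib_left divide_simps mult_ac)
  also have "\<dots> = block_gibbs \<beta> a (B 1) (B 2) (B 3) f"
  proof -
    let ?g = "\<lambda>s. merge (B 1) (B 3 \<union> B 2) (map_prod id (merge (B 3) (B 2)) s)"
    have "bij_betw (map_prod id (merge (B 3) (B 2))) (configs (B 1) (B 2) (B 3)) (signs (B 1) \<times> signs (B 3 \<union> B 2))"
      unfolding configs_def by (intro bij_betw_map_prod bij_betw_id bij_betw_merge_signs P)
    from bij_betw_trans[OF this bij_betw_merge_signs[OF P(5)]]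
    have bij: "bij_betw ?g (configs (B 1) (B 2) (B 3)) (spins N)"
      by (simp only: P(4) spins_def signs_def comp_def)
    have mean: "mean_spin (B 1) (?g (\<sigma>1, \<sigma>3, \<sigma>2)) = mean_spin (B 1) \<sigma>1"
      "mean_spin (B 2) (?g (\<sigma>1, \<sigma>3, \<sigma>2)) = mean_spin (B 2) \<sigma>2"
      "mean_spin (B 3) (?g (\<sigma>1, \<sigma>3, \<sigma>2)) = mean_spin (B 3) \<sigma>3" for \<sigma>1 \<sigma>2 \<sigma>3
      using P(5,6) by (simp_all add: mean_spin_merge mean_spin_merge_subset)
    have mag: "mag_vector B (?g s) = mags (B 1) (B 2) (B 3) s" for s
      by (cases s) (simp only: mag_vector_eq mags_def mean prod.case)
    have "?w (?g s) = indep_weight \<beta> (B 1) (B 2) (B 3) s * coupling a (mags (B 1) (B 2) (B 3) s)" for s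
      unfolding exp_minus_hamiltonian[OF card] mag a_def[symmetric]
      by (cases s) (simp only: indep_weight_def curie_weiss_weight_def mean prod.case)
    then show ?thesis
      unfolding wmean_bij[OF bij] mag by (simp only: block_gibbs_eq_wmean[OF P(1-3)])
  qed
  finally show ?thesis by (simp add: a_def)
qed

lemma integral_dirac_mixture:
  assumes "finite I" "\<And>i. i \<in> I \<Longrightarrow> 0 \<le> w i" "continuous_on UNIV (f :: 'a::topological_space \<Rightarrow> real)"
  shows "integral\<^sup>L (dirac_mixture I w x) f = (\<Sum>i\<in>I. w i * f (x i))"
proof -
  have "integral\<^sup>L (dirac_mixture I w x) f = integral\<^sup>L (point_measure I (\<lambda>i. ennreal (w i))) (\<lambda>i. f (x i))"
    unfolding dirac_mixture_def using assms(3)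
    by (intro integral_distr borel_measurable_continuous_onI) (simp_all add: point_measure_def)
  also have "\<dots> = (\<Sum>i\<in>I. w i * f (x i))"
    using assms by (subst lebesgue_integral_point_measure_finite) auto
  finally show ?thesis .
qed

section \<open>Weak limits of the magnetization vector\<close>

lemma eventually_adm_at_top:
  "eventually P (adm_at_top b) \<longleftrightarrow> (\<forall>\<^sub>F N in at_top. N \<in> admissible b \<longrightarrow> P N)"
  by (simp add: adm_at_top_def eventually_inf_principal)

lemma adm_at_top_le: "adm_at_top b \<le> at_top"
  by (simp add: adm_at_top_def)

theorem theorem2p4:
  fixes b :: "nat \<Rightarrow> nat" and B :: "nat \<Rightarrow> nat \<Rightarrow> nat set"
    and \<alpha> :: "nat \<Rightarrow> real" and \<beta> :: real
  assumes b_mono: "mono b"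
    and b_infinity: "filterlim b at_top at_top"
    and b_small: "(\<lambda>N. real (b N) / real N) \<longlonglongrightarrow> 0"
    and blocks: "\<And>N. N \<in> admissible b \<Longrightarrow> three_block_partition N (b N) (B N)"
    and beta: "\<beta> > 1"
    and alpha_pos: "\<And>N. N \<in> admissible b \<Longrightarrow> \<alpha> N > 0"
    and alpha_decreasing: "antimono_on (admissible b) \<alpha>"
    and alpha_zero: "(\<alpha> \<longlongrightarrow> 0) (adm_at_top b)"
  shows
    "(\<forall>c>0. ((\<lambda>N. \<alpha> N * sqrt (real N / real (b N))) \<longlongrightarrow> c) (adm_at_top b) \<longrightarrow>
        weakly_converges (\<lambda>N. mag_distr N (B N) \<beta> (\<alpha> N))
          (dirac_mixture {1, -1 :: real} (\<lambda>_. 1 / 2)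
             (\<lambda>s. (s * m_star \<beta>, s * m_field \<beta> c, s * m_star \<beta>)))
          (adm_at_top b))
     \<and>
     (\<forall>C>0. ((\<lambda>N. \<alpha> N * sqrt (real (b N) * real N)) \<longlongrightarrow> C) (adm_at_top b) \<longrightarrow>
        weakly_converges (\<lambda>N. mag_distr N (B N) \<beta> (\<alpha> N))
          (dirac_mixture ({-1, 1} \<times> {-1, 1} \<times> {-1, 1 :: real}) (\<lambda>x. weight_a \<beta> x C)
             (\<lambda>(\<chi>1, \<chi>2, \<chi>3). (\<chi>1 * m_star \<beta>, \<chi>2 * m_star \<beta>, \<chi>3 * m_star \<beta>)))
          (adm_at_top b))"
proof -
  let ?F = "adm_at_top b"
  let ?a = "\<lambda>N. \<alpha> N * sqrt (real (card (B N 1)) * real (card (B N 2)))"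
  have adm: "\<forall>\<^sub>F N in ?F. N \<in> admissible b" by (simp add: eventually_adm_at_top)
  have fin: "\<forall>\<^sub>F N in ?F. finite (B N 1) \<and> finite (B N 2) \<and> finite (B N 3)"
    using adm by eventually_elim (use blocks three_block_partitionD in blast)
  have cards: "\<forall>\<^sub>F N in ?F. real (card (B N 1)) = (real N - real (b N)) / 2 \<and>
      real (card (B N 2)) = real (b N) \<and> real (card (B N 3)) = (real N - real (b N)) / 2"
    using adm by eventually_elim (use blocks in \<open>auto simp: three_block_partition_def\<close>)
  have ratio_0: "((\<lambda>N. real (b N) / real N) \<longlongrightarrow> 0) ?F"
    using tendsto_mono[OF adm_at_top_le b_small] .
  have pos: "\<forall>\<^sub>F N in ?F. 0 < real N \<and> 0 < real (b N)"
    using filter_leD[OF adm_at_top_le, OF eventually_conj[OF eventually_gt_at_top[of 0]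
      filterlim_at_top[THEN iffD1, OF b_infinity, rule_format, of 1]]]
    by (rule eventually_mono) auto
  have outer_ratio: "((\<lambda>N. real (card (B N 1)) / real N) \<longlongrightarrow> 1 / 2) ?F"
  proof (rule Lim_transform_eventually)
    show "((\<lambda>N. (1 - real (b N) / real N) / 2) \<longlongrightarrow> 1 / 2) ?F"
      using tendsto_divide[OF tendsto_diff[OF tendsto_const[of 1] ratio_0] tendsto_const[of 2]] by simp
    show "\<forall>\<^sub>F N in ?F. (1 - real (b N) / real N) / 2 = real (card (B N 1)) / real N"
      using cards pos by eventually_elim (auto simp: diff_divide_distrib)
  qed
  have b_top: "filterlim (\<lambda>N. real (b N)) at_top ?F"
    using filterlim_mono[OF filterlim_compose[OF filterlim_real_sequentially b_infinity] order_refl adm_at_top_le] .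
  have N_top: "filterlim (\<lambda>N. real N) at_top ?F"
    using filterlim_mono[OF filterlim_real_sequentially order_refl adm_at_top_le] .
  have card2: "filterlim (\<lambda>N. real (card (B N 2))) at_top ?F"
    by (rule filterlim_mono_eventually[OF b_top order_refl order_refl]) (use cards in \<open>eventually_elim, simp\<close>)
  have card1: "filterlim (\<lambda>N. real (card (B N 1))) at_top ?F"
    by (rule filterlim_mono_eventually[OF filterlim_tendsto_pos_mult_at_top[OF outer_ratio _ N_top] order_refl order_refl])
      (use pos in \<open>simp, eventually_elim, simp\<close>)
  have card3: "filterlim (\<lambda>N. real (card (B N 3))) at_top ?F"
    by (rule filterlim_mono_eventually[OF card1 order_refl order_refl]) (use cards in \<open>eventually_elim, simp\<close>)
  \<comment> \<open>The coupling parameter involves \<open>sqrt |B1|\<close> where the hypotheses have \<open>sqrt N\<close>.\<close>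
  have sqrt_ratio: "((\<lambda>N. sqrt (real (card (B N 1)) / real N)) \<longlongrightarrow> 1 / sqrt 2) ?F"
    using tendsto_real_sqrt[OF outer_ratio] by (simp add: real_sqrt_divide)
  have integral: "\<forall>\<^sub>F N in ?F. block_gibbs \<beta> (?a N) (B N 1) (B N 2) (B N 3) f = integral\<^sup>L (mag_distr N (B N) \<beta> (\<alpha> N)) f"
    if "continuous_on UNIV f" for f :: "real \<times> real \<times> real \<Rightarrow> real"
    using adm by eventually_elim (simp add: integral_mag_distr[OF blocks that])
  have two_div_sqrt_2: "2 * (c * (1 / sqrt 2)) = sqrt 2 * c" for c :: real
  proof -
    have "2 * (c * (1 / sqrt 2)) = c * (2 / sqrt 2)" by simp
    also have "\<dots> = sqrt 2 * c" by (subst real_div_sqrt) auto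
    finally show ?thesis .
  qed
  show ?thesis
  proof (intro conjI allI impI)
    fix c :: real
    assume "0 < c" and lim: "((\<lambda>N. \<alpha> N * sqrt (real N / real (b N))) \<longlongrightarrow> c) ?F"
    let ?\<kappa> = "c * (1 / sqrt 2)"
    have a2: "((\<lambda>N. ?a N / real (card (B N 2))) \<longlongrightarrow> ?\<kappa>) ?F"
    proof (rule Lim_transform_eventually[OF tendsto_mult[OF lim sqrt_ratio]])
      show "\<forall>\<^sub>F N in ?F. \<alpha> N * sqrt (real N / real (b N)) * sqrt (real (card (B N 1)) / real N) =
          ?a N / real (card (B N 2))"
        using cards pos
      proof eventually_elim
        case (elim N)
        have "?a N / real (card (B N 2)) = \<alpha> N * sqrt (real (card (B N 1))) * (sqrt (real (b N)) / real (b N))"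
          using elim by (simp add: real_sqrt_mult)
        also have "\<dots> = \<alpha> N * sqrt (real N / real (b N)) * sqrt (real (card (B N 1)) / real N)"
          unfolding sqrt_divide_self_eq[OF of_nat_0_le_iff] using elim
          by (simp add: real_sqrt_divide field_simps)
        finally show ?case by (rule sym)
      qed
    qed
    have "((\<lambda>N. ?a N / real (card (B N 2)) * (real (b N) / real N) / (real (card (B N 1)) / real N)) \<longlongrightarrow> ?\<kappa> * 0 / (1 / 2)) ?F"
      by (intro tendsto_intros a2 ratio_0 outer_ratio) simp
    then have "((\<lambda>N. ?a N / real (card (B N 2)) * (real (b N) / real N) / (real (card (B N 1)) / real N)) \<longlongrightarrow> 0) ?F"
      by simp
    then have a1: "((\<lambda>N. ?a N / real (card (B N 1))) \<longlongrightarrow> 0) ?F"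
      by (rule Lim_transform_eventually) (use cards pos in \<open>eventually_elim, auto\<close>)
    have a3: "((\<lambda>N. ?a N / real (card (B N 3))) \<longlongrightarrow> 0) ?F"
      by (rule Lim_transform_eventually[OF a1]) (use cards in \<open>eventually_elim, simp\<close>)
    have m: "m_field \<beta> c = (GREATEST x. x = tanh (\<beta> * x + 2 * ?\<kappa> * m_star \<beta>))"
      by (simp only: m_field_def two_div_sqrt_2)
    show "weakly_converges (\<lambda>N. mag_distr N (B N) \<beta> (\<alpha> N))
        (dirac_mixture {1, -1 :: real} (\<lambda>_. 1 / 2)
           (\<lambda>s. (s * m_star \<beta>, s * m_field \<beta> c, s * m_star \<beta>))) ?F"
      unfolding weakly_converges_def
    proof (intro allI impI)
      fix f :: "real \<times> real \<times> real \<Rightarrow> real" assume "continuous_on UNIV f \<and> bounded (range f)"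
      then have f: "continuous_on UNIV f" by simp
      have "((\<lambda>N. integral\<^sup>L (mag_distr N (B N) \<beta> (\<alpha> N)) f) \<longlongrightarrow>
          (f (m_star \<beta>, m_field \<beta> c, m_star \<beta>) + f (- m_star \<beta>, - m_field \<beta> c, - m_star \<beta>)) / 2) ?F"
        unfolding m using \<open>0 < c\<close>
        by (intro Lim_transform_eventually[OF block_gibbs_tendsto_strong_coupling[OF beta fin card1 card2 card3 a1 a3 a2 _ f] integral[OF f]]) simp
      then show "((\<lambda>N. integral\<^sup>L (mag_distr N (B N) \<beta> (\<alpha> N)) f) \<longlongrightarrow>
          integral\<^sup>L (dirac_mixture {1, -1 :: real} (\<lambda>_. 1 / 2) (\<lambda>s. (s * m_star \<beta>, s * m_field \<beta> c, s * m_star \<beta>))) f) ?F"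
        using f by (simp add: integral_dirac_mixture add_divide_distrib)
    qed
  next
    fix C :: real
    assume "0 < C" and lim: "((\<lambda>N. \<alpha> N * sqrt (real (b N) * real N)) \<longlongrightarrow> C) ?F"
    define L where "L = C * (1 / sqrt 2)"
    let ?m = "m_star \<beta>"
    let ?I = "{-1, 1} \<times> {-1, 1} \<times> {-1, 1 :: real}"
    have a: "(?a \<longlongrightarrow> L) ?F"
      unfolding L_def
    proof (rule Lim_transform_eventually[OF tendsto_mult[OF lim sqrt_ratio]])
      show "\<forall>\<^sub>F N in ?F. \<alpha> N * sqrt (real (b N) * real N) * sqrt (real (card (B N 1)) / real N) = ?a N"
        using cards pos by eventually_elim (auto simp: real_sqrt_divide real_sqrt_mult)
    qed
    define E where "E = exp (sqrt 2 * C * ?m\<^sup>2)"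
    have E: "0 < E" by (simp add: E_def)
    have E_eq: "E = exp (2 * L * ?m\<^sup>2)" unfolding E_def L_def two_div_sqrt_2 ..
    have cpl: "coupling L (?m, ?m, ?m) = E" "coupling L (- ?m, - ?m, - ?m) = E"
      "coupling L (?m, - ?m, ?m) = 1 / E" "coupling L (- ?m, ?m, - ?m) = 1 / E"
      "coupling L (?m, s, - ?m) = 1" "coupling L (- ?m, s, ?m) = 1" for s
      by (auto simp: coupling_def E_eq power2_eq_square exp_minus field_simps)
    \<comment> \<open>The weights as in the definition, but expanded by \<open>E\<^sup>2\<close> so that no negative exponents remain.\<close>
    have wt: "weight_a \<beta> (s1, s2, s3) C = (if s1 = s2 \<and> s2 = s3 then E\<^sup>2 / (2 * (1 + E)\<^sup>2)
        else if s1 = s3 \<and> s3 = - s2 then 1 / (2 * (1 + E)\<^sup>2) else E / (2 * (1 + E)\<^sup>2))" for s1 s2 s3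
    proof -
      have e1: "exp (- sqrt 2 * C * ?m\<^sup>2) = 1 / E" by (simp add: E_def exp_minus field_simps)
      have e2: "exp (- 2 * sqrt 2 * C * ?m\<^sup>2) = 1 / E\<^sup>2"
        by (simp add: E_def exp_minus field_simps power2_eq_square flip: exp_add)
      have sq: "1 + 1 / E = (1 + E) / E" using E by (simp add: field_simps)
      show ?thesis unfolding weight_a_def e1 e2 prod.case sq using E
        by (simp add: power_divide power2_eq_square field_simps)
    qed
    show "weakly_converges (\<lambda>N. mag_distr N (B N) \<beta> (\<alpha> N))
        (dirac_mixture ?I (\<lambda>x. weight_a \<beta> x C)
           (\<lambda>(\<chi>1, \<chi>2, \<chi>3). (\<chi>1 * ?m, \<chi>2 * ?m, \<chi>3 * ?m))) ?F"
      unfolding weakly_converges_def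
    proof (intro allI impI)
      fix f :: "real \<times> real \<times> real \<Rightarrow> real" assume "continuous_on UNIV f \<and> bounded (range f)"
      then have f: "continuous_on UNIV f" by simp
      let ?S = "\<lambda>G. sign_average G (?m, ?m, ?m)"
      have "((\<lambda>N. integral\<^sup>L (mag_distr N (B N) \<beta> (\<alpha> N)) f) \<longlongrightarrow>
          ?S (\<lambda>v. coupling L v * f v) / ?S (coupling L)) ?F"
        by (rule Lim_transform_eventually[OF block_gibbs_tendsto_bounded_coupling[OF beta fin card1 card2 card3 a f] integral[OF f]])
      also have "?S (\<lambda>v. coupling L v * f v) / ?S (coupling L) =
          (\<Sum>s\<in>?I. weight_a \<beta> s C * f (case s of (\<chi>1, \<chi>2, \<chi>3) \<Rightarrow> (\<chi>1 * ?m, \<chi>2 * ?m, \<chi>3 * ?m)))"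
      proof -
        have Z: "?S (coupling L) = (1 + E)\<^sup>2 / (4 * E)"
          using E by (simp add: sign_average_def cpl power2_eq_square field_simps flip: sum.cartesian_product)
        define p where "p = (\<lambda>(\<chi>1, \<chi>2, \<chi>3). (\<chi>1 * ?m, \<chi>2 * ?m, \<chi>3 * ?m))"
        have "weight_a \<beta> s C = E / (2 * (1 + E)\<^sup>2) * coupling L (p s)" if "s \<in> ?I" for s
          using that E by (auto simp: p_def wt cpl power2_eq_square)
        then have "(\<Sum>s\<in>?I. weight_a \<beta> s C * f (p s)) = (\<Sum>s\<in>?I. E / (2 * (1 + E)\<^sup>2) * (coupling L (p s) * f (p s)))"
          by (intro sum.cong refl) (simp only: mult.assoc)
        also have "\<dots> = E / (2 * (1 + E)\<^sup>2) * (\<Sum>s\<in>?I. coupling L (p s) * f (p s))"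
          by (simp only: sum_distrib_left)
        also have "(\<Sum>s\<in>?I. coupling L (p s) * f (p s)) = 8 * ?S (\<lambda>v. coupling L v * f v)"
          unfolding sign_average_def prod.case p_def split_beta by (simp only: times_divide_eq_right) simp
        finally have "(\<Sum>s\<in>?I. weight_a \<beta> s C * f (p s)) = E / (2 * (1 + E)\<^sup>2) * (8 * ?S (\<lambda>v. coupling L v * f v))" .
        then show ?thesis unfolding p_def[symmetric] using E by (simp add: Z)
      qed
      also have "\<dots> = integral\<^sup>L (dirac_mixture ?I (\<lambda>x. weight_a \<beta> x C)
           (\<lambda>(\<chi>1, \<chi>2, \<chi>3). (\<chi>1 * ?m, \<chi>2 * ?m, \<chi>3 * ?m))) f"
        using f E by (subst integral_dirac_mixture) (auto simp: wt)
      finally show "((\<lambda>N. integral\<^sup>L (mag_distr N (B N) \<beta> (\<alpha> N)) f) \<longlongrightarrow>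
          integral\<^sup>L (dirac_mixture ?I (\<lambda>x. weight_a \<beta> x C)
           (\<lambda>(\<chi>1, \<chi>2, \<chi>3). (\<chi>1 * ?m, \<chi>2 * ?m, \<chi>3 * ?m))) f) ?F" .
    qed
  qed
qed

end
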